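(* Let $d\geq 2$, let $\mathbb{T}^d=\mathbb{R}^d/\mathbb{Z}^d$, and fix $\alpha>0$. Let $s>\frac{d+4}{2}$, $\nu_0\geq 0$ and $\nu_1\geq 0$. Suppose $a=(a_\hbar)_{0<\hbar\leq 1}$ is a family of functions in $\mathcal{C}^\infty(\mathbb{T}^d)$ such that for every $\beta\in\mathbb{N}^d$ there exists $C_\beta>0$ satisfying $$\forall\, 0<\hbar\leq 1,\ \forall x\in\mathbb{T}^d,\quad |\partial_x^\beta a_\hbar(x)|\leq C_\beta\,\hbar^{-\nu_1|\beta|}.\qquad( * )$$ Then there exists $\hbar_0>0$ such that, for any $0<\hbar\leq\hbar_0$ and for any orthonormal basis $(\psi_\hbar^j)_{j=1,\ldots,N(\hbar)}$ of $\mathcal{H}_\hbar=\mathbf{1}_{[1-\alpha\hbar,1+\alpha\hbar]}(-\hbar^2\Delta)L^2(\mathbb{T}^d)$ made of eigenfunctions of $-\hbar^2\Delta$, one has $$\frac{1}{N(\hbar)}\sum_{j=1}^{N(\hbar)}\left|\int_{\mathbb{T}^d}a_\hbar|\psi_\hbar^j|^2dx-\int_{\mathbb{T}^d}a_\hbar\,dx\right|^2\leq C\|a_\hbar\|^2_{L^2(\mathbb{T}^d)}\hbar^{\nu_0}+C\|a_\hbar\|^2_{H^s(\mathbb{T}^d)}\hbar^{2-2\nu_0}+C_a\,\hbar^{2-2(\nu_0+\nu_1)},$$ where the constant $C>0$ is independent of $a$, $\nu_0$ and $\nu_1$ (it may depend on $d$, $\alpha$, $s$), and where the constant $C_a>0$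 depends only (besides $d$, $\alpha$, $s$) on $\nu_0$, $\nu_1$ and on a finite number of the constants $C_\beta$ appearing in $( * )$, the multi-indices $\beta$ involved depending on the choice of $\nu_0$ and $\nu_1$. Neither constant depends on $\hbar$ or on the orthonormal basis.
   Context: $\mathbb{T}^d=\mathbb{R}^d/\mathbb{Z}^d$ carries the standard flat metric, $\Delta$ is its Laplacian, and $dx$ is the normalized volume measure; $H^s(\mathbb{T}^d)$ is the usual $L^2$-based Sobolev space of order $s$. The number $\alpha>0$ is fixed once and for all. For $0<\hbar\leq 1$, $\mathcal{H}_\hbar:=\mathbf{1}_{[1-\alpha\hbar,1+\alpha\hbar]}(-\hbar^2\Delta)L^2(\mathbb{T}^d)$ is the range of the spectral projector of $-\hbar^2\Delta$ onto $[1-\alpha\hbar,1+\alpha\hbar]$, i.e. the (finite-dimensional) span of the eigenfunctions of $-\hbar^2\Delta$ with eigenvalue in this interval, and $N(\hbar):=\dim\mathcal{H}_\hbar$. An orthonormal basis made of eigenfunctions means that each $\psi_\hbar^j$ satisfies $-\hbar^2\Delta\psi_\hbar^j=E_j(\hbar)\psi_\hbar^j$ for some $E_j(\hbar)\in[1-\alpha\hbar,1+\alpha\hbar]$. Here $\mathbb{N}=\{0,1,2,\dots\}$ and $|\beta|=\beta_1+\cdots+\beta_d$. *)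

theory Defs
  imports "HOL-Analysis.Analysis" "HOL-Library.Function_Algebras"
begin

text \<open>Functions on the torus \<open>\<real>\<^sup>d / \<int>\<^sup>d\<close> are represented by \<open>\<int>\<^sup>d\<close>-periodic functions on
  \<open>\<real>\<^sup>d\<close>; the dimension is \<open>d = CARD('n)\<close>.\<close>

definition lattice_vec :: "int^'n \<Rightarrow> real^'n" where
  "lattice_vec k = (\<chi> i. of_int (k $ i))"

definition periodic :: "(real^'n \<Rightarrow> complex) \<Rightarrow> bool" where
  "periodic f \<longleftrightarrow> (\<forall>x k. f (x + lattice_vec k) = f x)"

definition torus_integral :: "(real^'n \<Rightarrow> 'b::{banach,second_countable_topology}) \<Rightarrow> 'b" where
  "torus_integral f = (LINT x:cbox 0 1|lborel. f x)"

definition partial :: "'n::finite \<Rightarrow> (real^'n \<Rightarrow> complex) \<Rightarrow> real^'n \<Rightarrow> complex" where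
  "partial i f x = vector_derivative (\<lambda>t::real. f (x + t *\<^sub>R axis i 1)) (at 0)"

definition partials :: "'n::finite list \<Rightarrow> (real^'n \<Rightarrow> complex) \<Rightarrow> real^'n \<Rightarrow> complex" where
  "partials l f = foldr partial l f"

definition smooth :: "(real^'n::finite \<Rightarrow> complex) \<Rightarrow> bool" where
  "smooth f \<longleftrightarrow> (\<forall>l x. partials l f differentiable (at x))"

definition torus_smooth :: "(real^'n::finite \<Rightarrow> complex) \<Rightarrow> bool" where
  "torus_smooth f \<longleftrightarrow> periodic f \<and> smooth f"

text \<open>Since \<^typ>\<open>'n\<close> carries no order, the order of differentiation in \<open>\<partial>\<^sup>\<beta>\<close> is chosen arbitrarily;
  for smooth functions the result does not depend on it, as partial derivatives commute.\<close>

definition multi_partial :: "nat^'n \<Rightarrow> (real^'n::finite \<Rightarrow> complex) \<Rightarrow> real^'n \<Rightarrow> complex" where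
  "multi_partial \<beta> f = partials (SOME l. \<forall>i. count_list l i = \<beta> $ i) f"

definition multi_order :: "nat^'n::finite \<Rightarrow> nat" where
  "multi_order \<beta> = (\<Sum>i\<in>UNIV. \<beta> $ i)"

definition laplacian :: "(real^'n::finite \<Rightarrow> complex) \<Rightarrow> real^'n \<Rightarrow> complex" where
  "laplacian f x = (\<Sum>i\<in>UNIV. partial i (partial i f) x)"

definition L2_inner :: "(real^'n \<Rightarrow> complex) \<Rightarrow> (real^'n \<Rightarrow> complex) \<Rightarrow> complex" where
  "L2_inner f g = torus_integral (\<lambda>x. f x * cnj (g x))"

definition L2_norm :: "(real^'n \<Rightarrow> complex) \<Rightarrow> real" where
  "L2_norm f = sqrt (torus_integral (\<lambda>x. (cmod (f x))\<^sup>2))"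

definition fourier_coeff :: "(real^'n::finite \<Rightarrow> complex) \<Rightarrow> int^'n \<Rightarrow> complex" where
  "fourier_coeff f k = torus_integral (\<lambda>x. f x * cis (- 2 * pi * (lattice_vec k \<bullet> x)))"

text \<open>The norm of \<open>(1 - \<Delta>)\<close> to the power \<open>s/2\<close> applied to \<open>f\<close>. It is only meaningful for
  \<open>f \<in> H\<^sup>s\<close> (for instance smooth \<open>f\<close>), because \<^const>\<open>infsum\<close> is \<open>0\<close> for divergent series.\<close>

definition sobolev_norm :: "real \<Rightarrow> (real^'n::finite \<Rightarrow> complex) \<Rightarrow> real" where
  "sobolev_norm s f = sqrt (\<Sum>\<^sub>\<infinity>k\<in>UNIV.
     (1 + 4 * pi\<^sup>2 * (norm (lattice_vec k :: real^'n))\<^sup>2) powr s * (cmod (fourier_coeff f k))\<^sup>2)"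

interpretation cfun: vector_space "\<lambda>(c::complex) (f :: real^'n::finite \<Rightarrow> complex) x. c * f x"
  by unfold_locales (auto simp: fun_eq_iff algebra_simps)

definition eigenfunction :: "real \<Rightarrow> real \<Rightarrow> (real^'n::finite \<Rightarrow> complex) \<Rightarrow> bool" where
  "eigenfunction h E \<psi> \<longleftrightarrow> torus_smooth \<psi> \<and> (\<exists>x. \<psi> x \<noteq> 0) \<and>
     (\<forall>x. - of_real (h\<^sup>2) * laplacian \<psi> x = of_real E * \<psi> x)"

definition spectral_window :: "real \<Rightarrow> real \<Rightarrow> real set" where
  "spectral_window \<alpha> h = {1 - \<alpha> * h .. 1 + \<alpha> * h}"

text \<open>By elliptic regularity every \<open>L\<^sup>2\<close> eigenfunction has a unique smooth representative, so the
  range of the spectral projector is identified with a space of smooth functions.\<close>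

definition spectral_space :: "real \<Rightarrow> real \<Rightarrow> (real^'n::finite \<Rightarrow> complex) set" where
  "spectral_space \<alpha> h = cfun.span {\<psi>. \<exists>E\<in>spectral_window \<alpha> h. eigenfunction h E \<psi>}"

definition spectral_dim :: "'n::finite itself \<Rightarrow> real \<Rightarrow> real \<Rightarrow> nat" where
  "spectral_dim _ \<alpha> h = cfun.dim (spectral_space \<alpha> h :: (real^'n \<Rightarrow> complex) set)"

definition eigen_onb :: "real \<Rightarrow> real \<Rightarrow> (nat \<Rightarrow> real^'n::finite \<Rightarrow> complex) \<Rightarrow> bool" where
  "eigen_onb \<alpha> h \<psi> \<longleftrightarrow>
     (\<forall>j\<in>{1..spectral_dim TYPE('n) \<alpha> h}. \<exists>E\<in>spectral_window \<alpha> h. eigenfunction h E (\<psi> j)) \<and>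
     (\<forall>i\<in>{1..spectral_dim TYPE('n) \<alpha> h}. \<forall>j\<in>{1..spectral_dim TYPE('n) \<alpha> h}.
        L2_inner (\<psi> i) (\<psi> j) = (if i = j then 1 else 0)) \<and>
     cfun.span (\<psi> ` {1..spectral_dim TYPE('n) \<alpha> h}) = spectral_space \<alpha> h"

definition symbol_bounds ::
    "real \<Rightarrow> (nat^'n::finite \<Rightarrow> real) \<Rightarrow> (real \<Rightarrow> real^'n \<Rightarrow> complex) \<Rightarrow> bool" where
  "symbol_bounds \<nu>1 c a \<longleftrightarrow> (\<forall>\<beta>. 0 < c \<beta> \<and>
     (\<forall>h\<in>{0<..1}. \<forall>x. cmod (multi_partial \<beta> (a h) x) \<le> c \<beta> * h powr (- \<nu>1 * real (multi_order \<beta>))))"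

end

theory Submission
  imports Defs
begin

text \<open>An eigenfunction is a finite trigonometric polynomial whose frequencies lie on one sphere, so
  \<open>\<integral> a |\<psi>\<^sub>j|\<^sup>2 - \<integral> a\<close> is a diagonal element of the matrix with entries \<open>a^(l - k)\<close>, \<open>k \<noteq> l\<close>,
  \<open>|k| = |l|\<close>, restricted to the frequencies \<open>k\<close> of the window. Its Hilbert--Schmidt norm bounds the
  variance by the sum over \<open>m \<noteq> 0\<close> of \<open>|a^(m)|\<^sup>2\<close> times the proportion of those \<open>k\<close> that lie on the
  hyperplane \<open>2 k \<bullet> m = - |m|\<^sup>2\<close>. An elementary count shows that this proportion is \<open>O(h)\<close> as long as
  \<open>|m| \<le> const / h\<close>; the remaining \<open>m\<close> cost only a factor \<open>h\<^sup>2 (1 + |m|\<^sup>2)\<close>. The variance is therefore at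
  most \<open>C h \<parallel>a\<parallel>\<^sup>2 + C h\<^sup>2 \<parallel>a\<parallel>\<^sup>2\<close> with the \<open>L\<^sup>2\<close> and Sobolev norms respectively, which suffices for
  \<open>\<nu>0 \<le> 1\<close>. If \<open>\<nu>0 + \<nu>1 \<ge> 1\<close>, the last term of the claim dominates the trivial bound
  \<open>4 (sup |a|)\<^sup>2\<close>.\<close>

section \<open>Integration over the torus\<close>

text \<open>The delicate point is the proportion O(h). Measured in |k|, the window has radius about
  1/(2 pi h) and a width that tends to \<alpha>/(2 pi) as h tends to 0. This may be far below 1, so
  comparing volumes of unit cells gives no lower bound for the number of lattice points. The shell
  is therefore filled by an explicit construction, which yields order h^-(d-1) points. On a
  hyperplane section, |k|^2 varies with slope of order 1/h along suitable lines, while its window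
  has length of order 1/h. A line thus meets the window in boundedly many lattice points, and order
  h^-(d-2) points remain. The bound on |m| keeps the hyperplane away from tangency to the sphere,
  where these slopes degenerate. Eigenfunctions are given only as smooth periodic solutions of the
  eigenvalue equation. Their finite expansion needs injectivity of the Fourier coefficients on
  continuous periodic functions, which is proved with concentrating powers of a trigonometric
  polynomial. The finite expansion then spares every question of convergence for the
  \<psi>_j.\<close>

lemma torus_integral_HK:
  fixes f :: "real^'n::finite \<Rightarrow> 'b::euclidean_space"
  assumes "continuous_on UNIV f"
  shows "torus_integral f = integral (cbox 0 1) f"
proof -
  have "set_integrable lborel (cbox 0 1) f"
    unfolding set_integrable_def
    by (intro borel_integrable_compact compact_cbox) (use assms continuous_on_subset in blast)
  then show ?thesis
    unfolding torus_integral_def by (rule set_borel_integral_eq_integral)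
qed

lemma continuous_integrable_box:
  fixes f :: "real^'n::finite \<Rightarrow> 'b::euclidean_space"
  assumes "continuous_on UNIV f"
  shows "f integrable_on cbox a b"
  using assms by (intro integrable_continuous) (use continuous_on_subset in blast)

lemma torus_integral_add:
  fixes f g :: "real^'n::finite \<Rightarrow> 'b::euclidean_space"
  assumes "continuous_on UNIV f" "continuous_on UNIV g"
  shows "torus_integral (\<lambda>x. f x + g x) = torus_integral f + torus_integral g"
  using assms by (simp add: torus_integral_HK continuous_on_add integral_add continuous_integrable_box)

lemma torus_integral_diff:
  fixes f g :: "real^'n::finite \<Rightarrow> 'b::euclidean_space"
  assumes "continuous_on UNIV f" "continuous_on UNIV g"
  shows "torus_integral (\<lambda>x. f x - g x) = torus_integral f - torus_integral g"
  using assms by (simp add: torus_integral_HK continuous_on_diff integral_diff continuous_integrable_box)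

lemma torus_integral_sum:
  fixes f :: "'i \<Rightarrow> real^'n::finite \<Rightarrow> 'b::euclidean_space"
  assumes "finite S" "\<And>i. i \<in> S \<Longrightarrow> continuous_on UNIV (f i)"
  shows "torus_integral (\<lambda>x. \<Sum>i\<in>S. f i x) = (\<Sum>i\<in>S. torus_integral (f i))"
  using assms by (simp add: torus_integral_HK continuous_on_sum integral_sum continuous_integrable_box)

lemma torus_integral_cmult:
  fixes f :: "real^'n::finite \<Rightarrow> complex"
  assumes "continuous_on UNIV f"
  shows "torus_integral (\<lambda>x. c * f x) = c * torus_integral f"
  using assms by (simp add: torus_integral_HK continuous_on_mult continuous_on_const)

lemma torus_integral_of_real:
  fixes f :: "real^'n::finite \<Rightarrow> real"
  assumes "continuous_on UNIV f"
  shows "torus_integral (\<lambda>x. complex_of_real (f x)) = of_real (torus_integral f)"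
  by (simp add: torus_integral_def set_lebesgue_integral_def flip: integral_complex_of_real)
    (simp add: scaleR_conv_of_real)

lemma torus_integral_mono:
  fixes f g :: "real^'n::finite \<Rightarrow> real"
  assumes "continuous_on UNIV f" "continuous_on UNIV g" "\<And>x. f x \<le> g x"
  shows "torus_integral f \<le> torus_integral g"
  using assms by (simp add: torus_integral_HK integral_le continuous_integrable_box)

lemma content_unit_box: "measure lborel (cbox 0 (1::real^'n::finite)) = 1"
  by (simp add: content_cbox_cart interval_ne_empty_cart)

lemma torus_integral_const:
  "torus_integral (\<lambda>x::real^'n::finite. c :: 'b::euclidean_space) = c"
  by (simp add: torus_integral_HK continuous_on_const content_unit_box)

lemma torus_integral_norm_le:
  fixes f :: "real^'n::finite \<Rightarrow> complex"
  assumes "continuous_on UNIV f"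
  shows "cmod (torus_integral f) \<le> torus_integral (\<lambda>x. cmod (f x))"
  using assms
  by (simp add: torus_integral_HK continuous_on_norm integral_norm_bound_integral
      continuous_integrable_box)

text \<open>The translated cell differs from the unit cell by a slab that periodicity moves back by
  the lattice vector in direction \<open>i\<close>. Translations with 0 \<le> t \<le> 1 are enough,
  since only a one-sided derivative at 0 is taken from this.\<close>

lemma torus_integral_shift:
  fixes g :: "real^'n::finite \<Rightarrow> complex"
  assumes cont: "continuous_on UNIV g" and per: "periodic g" and t: "0 \<le> t" "t \<le> 1"
  shows "integral (cbox 0 1) (\<lambda>x. g (x + t *\<^sub>R axis i 1)) = integral (cbox 0 1) g"
proof -
  let ?e = "axis i (1::real)"
  \<comment> \<open>\<open>m\<close> is the upper corner of the slab 0 \<le> x_i \<le> t of the unit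
    cell.\<close>
  define m where "m = ((\<chi> j. if j = i then t else 1) :: real^'n)"
  have e: "?e \<in> (Basis :: (real^'n) set)" by (simp add: axis_in_Basis_iff)
  have shift_e: "g (x + ?e) = g x" for x
  proof -
    have "lattice_vec (\<chi> j. if j = i then 1 else 0) = ?e"
      by (simp add: lattice_vec_def vec_eq_iff axis_def)
    then show ?thesis using per unfolding periodic_def by metis
  qed
  have split: "integral (cbox a b) g = integral (cbox a (\<chi> j. if j = i then min (b$j) c else b$j)) g +
      integral (cbox (\<chi> j. if j = i then max (a$j) c else a$j) b) g" for a b c
  proof -
    have "cbox a b \<inter> {x. x \<bullet> ?e \<le> c} = cbox a (\<chi> j. if j = i then min (b$j) c else b$j)"
      "cbox a b \<inter> {x. c \<le> x \<bullet> ?e} = cbox (\<chi> j. if j = i then max (a$j) c else a$j) b"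
      using interval_split_cart[where a = a and b = b and k = i and c = c] by (simp_all add: interval_cbox_cart inner_axis cong: if_cong)
    then show ?thesis
      using integral_split[OF continuous_integrable_box[OF cont] e, of a b c] by simp
  qed
  have "integral (cbox 0 1) (\<lambda>x. g (x + t *\<^sub>R ?e)) = integral (cbox (t *\<^sub>R ?e) (1 + t *\<^sub>R ?e)) g"
    using integral_shift_cbox[of "t *\<^sub>R ?e" "t *\<^sub>R ?e" "1 + t *\<^sub>R ?e" g] by simp
  also have "\<dots> = integral (cbox (t *\<^sub>R ?e) 1) g + integral (cbox ?e (1 + t *\<^sub>R ?e)) g"
  proof -
    have "(\<chi> j. if j = i then min ((1 + t *\<^sub>R ?e) $ j) 1 else (1 + t *\<^sub>R ?e) $ j) = (1::real^'n)"
      "(\<chi> j. if j = i then max ((t *\<^sub>R ?e) $ j) 1 else (t *\<^sub>R ?e) $ j) = ?e"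
      using t by (auto simp: vec_eq_iff axis_def)
    then show ?thesis using split[of "t *\<^sub>R ?e" "1 + t *\<^sub>R ?e" 1] by simp
  qed
  also have "integral (cbox ?e (1 + t *\<^sub>R ?e)) g = integral (cbox 0 m) g"
  proof -
    have "(1 + t *\<^sub>R ?e) - ?e = m"
      by (auto simp: vec_eq_iff axis_def m_def)
    then show ?thesis
      using integral_shift_cbox[of ?e ?e "1 + t *\<^sub>R ?e" g] by (simp add: shift_e)
  qed
  also have "integral (cbox (t *\<^sub>R ?e) 1) g + integral (cbox 0 m) g = integral (cbox 0 1) g"
  proof -
    have "(\<chi> j. if j = i then min ((1::real^'n) $ j) t else (1::real^'n) $ j) = m"
      "(\<chi> j. if j = i then max ((0::real^'n) $ j) t else (0::real^'n) $ j) = t *\<^sub>R ?e"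
      using t by (auto simp: vec_eq_iff axis_def m_def)
    then show ?thesis using split[of 0 1 t] by simp
  qed
  finally show ?thesis .
qed

text \<open>\<open>partial\<close> differentiates at parameter 0 only. Recentring the line at its
  point with parameter \<open>t\<close> gives the derivative along the whole line, as
  differentiation under the integral requires.\<close>

lemma has_vector_derivative_partial:
  fixes g :: "real^'n::finite \<Rightarrow> complex"
  assumes "\<And>x. g differentiable (at x)"
  shows "((\<lambda>t. g (x + t *\<^sub>R axis i 1)) has_vector_derivative partial i g (x + t *\<^sub>R axis i 1)) (at t)"
proof -
  let ?F = "\<lambda>x t. g (x + t *\<^sub>R axis i 1)"
  have diff: "?F x differentiable (at t)" for x t
  proof -
    have "(g \<circ> (\<lambda>t. x + t *\<^sub>R axis i 1)) differentiable (at t)"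
      by (intro differentiable_chain_at assms derivative_intros)
    then show ?thesis by (simp add: o_def)
  qed
  have "((?F (x + t *\<^sub>R axis i 1) \<circ> (\<lambda>u. u - t)) has_vector_derivative
      (1 *\<^sub>R partial i g (x + t *\<^sub>R axis i 1))) (at t)"
    apply (rule vector_diff_chain_at)
     apply (auto intro!: derivative_eq_intros)[1]
    using diff[of "x + t *\<^sub>R axis i 1" 0] by (simp add: partial_def vector_derivative_works)
  moreover have "?F (x + t *\<^sub>R axis i 1) \<circ> (\<lambda>u. u - t) = ?F x"
    by (auto simp: algebra_simps)
  ultimately show ?thesis by simp
qed

lemma partial_eqI:
  assumes "((\<lambda>t. g (x + t *\<^sub>R axis i 1)) has_vector_derivative D) (at 0)"
  shows "partial i g x = D"
  unfolding partial_def using assms by (rule vector_derivative_at)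

text \<open>The integral of a translate does not depend on the translation; differentiating under
  the integral sign at 0 gives the result. Applied to products with characters, this is integration
  by parts without boundary terms.\<close>

lemma integral_partial_zero:
  fixes g :: "real^'n::finite \<Rightarrow> complex"
  assumes diff: "\<And>x. g differentiable (at x)" and cont: "continuous_on UNIV (partial i g)"
    and per: "periodic g"
  shows "torus_integral (partial i g) = 0"
proof -
  have contg: "continuous_on UNIV g"
    using diff by (simp add: continuous_at_imp_continuous_on differentiable_imp_continuous_within)
  let ?G = "\<lambda>t. integral (cbox 0 1) (\<lambda>x. g (x + t *\<^sub>R axis i 1))"
  have "(?G has_vector_derivative integral (cbox 0 1) (\<lambda>x. partial i g (x + 0 *\<^sub>R axis i 1)))
      (at 0 within {0..1})"
  proof (rule leibniz_rule_vector_derivative[where f = "\<lambda>t x. g (x + t *\<^sub>R axis i 1)"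
        and fx = "\<lambda>t x. partial i g (x + t *\<^sub>R axis i 1)" and U = "{0..1}"])
    show "((\<lambda>t. g (x + t *\<^sub>R axis i 1)) has_vector_derivative partial i g (x + t *\<^sub>R axis i 1))
        (at t within {0..1})" for x t
      by (rule has_vector_derivative_at_within[OF has_vector_derivative_partial[OF diff]])
    show "(\<lambda>x. g (x + t *\<^sub>R axis i 1)) integrable_on cbox 0 1" for t
      by (intro continuous_integrable_box continuous_on_compose2[OF contg] continuous_intros) auto
    show "continuous_on ({0..1} \<times> cbox 0 1) (\<lambda>(t, x). partial i g (x + t *\<^sub>R axis i 1))"
      unfolding case_prod_beta
      by (intro continuous_on_compose2[OF cont] continuous_intros) auto
  qed auto
  \<comment> \<open>Constancy of the translated integral is available only on [0,1], so both
    derivatives are taken within that interval. They agree because 0 is a limit point of it.\<close>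
  moreover have "(?G has_vector_derivative 0) (at 0 within {0..1})"
    by (rule has_vector_derivative_transform[where f = "\<lambda>_. integral (cbox 0 1) g"])
      (auto simp: torus_integral_shift[OF contg per])
  ultimately have "integral (cbox 0 1) (\<lambda>x. partial i g (x + 0 *\<^sub>R axis i 1)) = 0"
    by (intro vector_derivative_unique_within[of 0 "{0..1}"]) 
      (auto simp: trivial_limit_within islimpt_Icc)
  then show ?thesis by (simp add: torus_integral_HK[OF cont])
qed

section \<open>Lattice points in spherical shells\<close>

lemma lattice_vec_nth [simp]: "lattice_vec k $ i = of_int (k $ i)"
  by (simp add: lattice_vec_def)

lemma lattice_vec_add: "lattice_vec (k + l) = lattice_vec k + lattice_vec l"
  and lattice_vec_uminus: "lattice_vec (- k) = - lattice_vec k"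
  and lattice_vec_0 [simp]: "lattice_vec 0 = 0"
  by (simp_all add: vec_eq_iff)

lemma norm_sq_vec: "(norm (x::real^'n::finite))\<^sup>2 = (\<Sum>i\<in>UNIV. (x $ i)\<^sup>2)"
  by (simp add: norm_vec_def L2_set_def sum_nonneg)

lemma card_vec_box:
  fixes S :: "'n::finite \<Rightarrow> 'a set"
  shows "card {u :: 'a^'n. \<forall>l. u $ l \<in> S l} = (\<Prod>l\<in>UNIV. card (S l))"
proof -
  have "bij_betw vec_nth {u :: 'a^'n. \<forall>l. u $ l \<in> S l} (PiE UNIV S)"
    by (intro bij_betwI[of _ _ _ vec_lambda]) (auto simp: PiE_UNIV_domain)
  then show ?thesis
    by (simp add: bij_betw_same_card card_PiE)
qed

lemma finite_vec_box:
  fixes S :: "'n::finite \<Rightarrow> 'a set"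
  assumes "\<And>l. finite (S l)"
  shows "finite {u :: 'a^'n. \<forall>l. u $ l \<in> S l}"
proof -
  have "bij_betw vec_nth {u :: 'a^'n. \<forall>l. u $ l \<in> S l} (PiE UNIV S)"
    by (intro bij_betwI[of _ _ _ vec_lambda]) (auto simp: PiE_UNIV_domain)
  then show ?thesis
    using assms by (simp add: bij_betw_finite finite_PiE)
qed

lemma abs_coord_le_norm_lattice_vec:
  assumes "(norm (lattice_vec k :: real^'n::finite))\<^sup>2 \<le> R\<^sup>2" "0 \<le> R"
  shows "k $ l \<in> {- \<lfloor>R\<rfloor>..\<lfloor>R\<rfloor>}"
proof -
  have "norm (lattice_vec k :: real^'n) \<le> R"
    using assms by (simp add: abs_le_square_iff[symmetric])
  then have "\<bar>real_of_int (k $ l)\<bar> \<le> R"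
    using component_le_norm_cart[of "lattice_vec k :: real^'n" l] by simp
  then show ?thesis by (auto simp: le_floor_iff) linarith
qed

lemma finite_lattice_ball:
  "finite {k :: int^'n::finite. (norm (lattice_vec k :: real^'n))\<^sup>2 \<le> B}"
proof (cases "0 \<le> B")
  case True
  then have "{k :: int^'n. (norm (lattice_vec k :: real^'n))\<^sup>2 \<le> B} \<subseteq>
      {u. \<forall>l. u $ l \<in> {- \<lfloor>sqrt B\<rfloor>..\<lfloor>sqrt B\<rfloor>}}"
    using abs_coord_le_norm_lattice_vec[where R = "sqrt B"] by auto
  then show ?thesis by (rule finite_subset) (intro finite_vec_box, simp)
next
  case False
  then have "{k :: int^'n. (norm (lattice_vec k :: real^'n))\<^sup>2 \<le> B} = {}"
    by (smt (verit) Collect_empty_eq zero_le_power2)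
  then show ?thesis by simp
qed

text \<open>Here \<open>p j k\<close> is the scalar product of \<open>k\<close> with e_j - (m_j /
  m_i) e_i, a vector orthogonal to \<open>m\<close>. It is half the slope of |k|^2 along a line
  inside the hyperplane, so a lower bound for it with a fixed sign limits the lattice points of the
  class on that line to \<open>q\<close>. The other d - 2 coordinates number the lines.\<close>

lemma card_shell_hyperplane_class:
  fixes m :: "int^'n::finite" and A L R \<delta> \<sigma> :: real and q :: nat and i j :: "'n"
  defines "p \<equiv> \<lambda>j k. of_int (k $ j) - of_int (m $ j) / of_int (m $ i) * of_int (k $ i) :: real"
  defines "H \<equiv> {k. A \<le> (norm (lattice_vec k :: real^'n))\<^sup>2 \<and> (norm (lattice_vec k :: real^'n))\<^sup>2 \<le> A + L
      \<and> (norm (lattice_vec (k + m) :: real^'n))\<^sup>2 = (norm (lattice_vec k :: real^'n))\<^sup>2}"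
  assumes mi: "m $ i \<noteq> 0" and ij: "i \<noteq> j" and R: "0 \<le> R" "A + L \<le> R\<^sup>2" and \<delta>: "0 < \<delta>"
    and q: "L < 2 * \<delta> * real q" and \<sigma>: "\<sigma>\<^sup>2 = 1"
  shows "real (card {k \<in> H. \<delta> \<le> \<sigma> * p j k}) \<le> real q * (2 * R + 1) ^ (CARD('n) - 2)"
proof -
  let ?v = "lattice_vec :: int^'n \<Rightarrow> real^'n"
  let ?C = "{k \<in> H. \<delta> \<le> \<sigma> * p j k}"
  \<comment> \<open>Fixing the coordinates other than \<open>i\<close> and \<open>j\<close> leaves a line, along which \<open>|k|\<^sup>2\<close> grows at
    rate at least \<open>2 \<delta>\<close>; the values of \<open>k $ j\<close> in the shell then differ by less than \<open>q\<close>, so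
    \<open>k $ j mod q\<close> determines \<open>k\<close>.\<close>
  define enc :: "int^'n \<Rightarrow> int^'n" where
    "enc k = (\<chi> l. if l = i then 0 else if l = j then k $ j mod int q else k $ l)" for k
  define S where "S l = (if l = i then {0} else if l = j then {0..<int q} else {- \<lfloor>R\<rfloor>..\<lfloor>R\<rfloor>})" for l
  have nn: "(norm (?v k))\<^sup>2 = ?v k \<bullet> ?v k" for k
    by (simp add: power2_norm_eq_inner)
  have H_iff: "2 * (?v k \<bullet> ?v m) + ?v m \<bullet> ?v m = 0" if "k \<in> H" for k
    using that by (simp add: H_def power2_norm_eq_inner lattice_vec_add algebra_simps inner_commute)
  \<comment> \<open>Convexity: the expansion of |k'|^2 around \<open>k\<close> contains the term t^2
    |w|^2 \<ge> 0, which is dropped. The linear term alone is then at most the gain in |k|^2, and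
    that is at most \<open>L\<close>.\<close>
  have key: "2 * (of_int (k' $ j) - of_int (k $ j)) * p j k \<le> L"
    if k: "k \<in> H" and k': "k' \<in> H" and same: "\<And>l. l \<noteq> i \<Longrightarrow> l \<noteq> j \<Longrightarrow> k $ l = k' $ l" for k k'
  proof -
    define t where "t = (of_int (k' $ j) - of_int (k $ j) :: real)"
    define w where "w = (axis j 1 - (of_int (m $ j) / of_int (m $ i)) *\<^sub>R axis i 1 :: real^'n)"
    \<comment> \<open>Both points satisfy 2 k \<bullet> m = - |m|^2, so their difference is
      orthogonal to \<open>m\<close>; a change of coordinate \<open>j\<close> therefore forces the
      change of coordinate \<open>i\<close>.\<close>
    have orth: "(?v k' - ?v k) \<bullet> ?v m = 0"
      using H_iff[OF k] H_iff[OF k'] by (simp add: inner_diff_left)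
    have "(?v k' - ?v k) \<bullet> ?v m = (\<Sum>l\<in>{i,j}. (?v k' - ?v k) $ l * ?v m $ l)"
      unfolding inner_vec_def using same by (intro sum.mono_neutral_cong_right) auto
    also have "\<dots> = (of_int (k' $ i) - of_int (k $ i)) * of_int (m $ i) + t * of_int (m $ j)"
      using ij by (simp add: t_def)
    finally have "(of_int (k' $ i) - of_int (k $ i)) * of_int (m $ i) = - t * of_int (m $ j)"
      using orth by linarith
    then have ki: "of_int (k' $ i) - of_int (k $ i) = - t * (of_int (m $ j) / of_int (m $ i))"
      using mi by (simp add: field_simps)
    have eq: "?v k' = ?v k + t *\<^sub>R w"
    proof (rule vec_eq_iff[THEN iffD2], intro allI)
      fix l
      show "?v k' $ l = (?v k + t *\<^sub>R w) $ l"
      proof (cases "l = i")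
        case True
        then show ?thesis using ki ij mi by (simp add: w_def axis_def field_simps)
      next
        case False
        then show ?thesis using same[of l] by (cases "l = j") (auto simp: w_def axis_def t_def)
      qed
    qed
    have pw: "?v k \<bullet> w = p j k"
      by (simp add: w_def p_def inner_diff_right inner_axis)
    have "?v k' \<bullet> ?v k' = ?v k \<bullet> ?v k + 2 * t * p j k + t * t * (w \<bullet> w)"
      by (simp add: eq algebra_simps inner_commute flip: pw)
    moreover have "0 \<le> t * t * (w \<bullet> w)" by simp
    moreover have "?v k' \<bullet> ?v k' - ?v k \<bullet> ?v k \<le> L"
      using k k' by (simp add: H_def nn)
    ultimately show ?thesis unfolding t_def[symmetric] by linarith
  qed
  have inj: "inj_on enc ?C"
  proof (rule inj_onI)
    fix k k' assume k: "k \<in> ?C" and k': "k' \<in> ?C" and enc: "enc k = enc k'"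
    have same: "k $ l = k' $ l" if "l \<noteq> i" "l \<noteq> j" for l
      using arg_cong[OF enc, of "\<lambda>u. u $ l"] that by (simp add: enc_def)
    have cong: "k $ j mod int q = k' $ j mod int q"
      using arg_cong[OF enc, of "\<lambda>u. u $ j"] ij by (simp add: enc_def)
    have \<sigma>': "\<sigma> = 1 \<or> \<sigma> = -1" using \<sigma> by (simp add: power2_eq_1_iff)
    define t where "t = (of_int (k' $ j) - of_int (k $ j) :: real)"
    have 1: "2 * t * p j k \<le> L" "2 * (- t) * p j k' \<le> L"
      using key[of k k'] key[of k' k] same k k' by (auto simp: t_def)
    \<comment> \<open>The convexity bound is useful only from the endpoint where |k|^2 increases
      towards the other one; the sign of \<sigma> * t selects it.\<close>
    have "\<delta> * \<bar>t\<bar> \<le> t * p j k \<or> \<delta> * \<bar>t\<bar> \<le> (- t) * p j k'"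
    proof (cases "0 \<le> \<sigma> * t")
      case True
      have "\<bar>t\<bar> * \<delta> \<le> \<bar>t\<bar> * (\<sigma> * p j k)" using k by (intro mult_left_mono) auto
      with True \<sigma>' show ?thesis by (auto simp: algebra_simps)
    next
      case False
      have "\<bar>t\<bar> * \<delta> \<le> \<bar>t\<bar> * (\<sigma> * p j k')" using k' by (intro mult_left_mono) auto
      with False \<sigma>' show ?thesis by (auto simp: algebra_simps)
    qed
    with 1 have "2 * \<delta> * \<bar>t\<bar> \<le> L" by linarith
    with q have "2 * \<delta> * \<bar>t\<bar> < 2 * \<delta> * real q" by linarith
    with \<delta> have tq: "\<bar>t\<bar> < real q" by simp
    have kj: "k $ j = k' $ j"
    proof (rule ccontr)
      assume "k $ j \<noteq> k' $ j"
      moreover have "int q dvd k' $ j - k $ j" using cong by (metis mod_eq_dvd_iff)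
      ultimately have "int q \<le> \<bar>k' $ j - k $ j\<bar>"
        by (metis abs_of_nat dvd_imp_le_int eq_iff_diff_eq_0)
      then have "real q \<le> \<bar>t\<bar>" unfolding t_def by linarith
      with tq show False by simp
    qed
    \<comment> \<open>Once all other coordinates agree, the hyperplane equation fixes coordinate
      \<open>i\<close>, because m_i is nonzero.\<close>
    have "(of_int (k $ i) - of_int (k' $ i)) * of_int (m $ i) = (0::real)"
    proof -
      have "(?v k - ?v k') \<bullet> ?v m = 0"
        using H_iff[of k] H_iff[of k'] k k' by (simp add: inner_diff_left)
      moreover have "(?v k - ?v k') \<bullet> ?v m = (\<Sum>l\<in>{i}. (?v k - ?v k') $ l * ?v m $ l)"
        unfolding inner_vec_def using same kj by (intro sum.mono_neutral_cong_right) auto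
      ultimately show ?thesis by simp
    qed
    with mi have "k $ i = k' $ i" by simp
    with same kj show "k = k'" by (metis vec_eq_iff)
  qed
  have fin: "finite (S l)" for l by (simp add: S_def)
  \<comment> \<open>For q = 0 the operation \<open>mod\<close> returns its first argument, which
    would fall outside the empty range of residues.\<close>
  have q0: "q \<noteq> 0" if "?C \<noteq> {}"
  proof -
    from that have "0 \<le> L" by (auto simp: H_def)
    with q show ?thesis by (cases q) auto
  qed
  have "enc ` ?C \<subseteq> {u. \<forall>l. u $ l \<in> S l}"
  proof (clarsimp simp: subset_iff)
    fix k l assume k: "k \<in> H" "\<delta> \<le> \<sigma> * p j k"
    then have "(norm (?v k))\<^sup>2 \<le> R\<^sup>2" using R(2) unfolding H_def mem_Collect_eq by linarith
    then have "k $ l \<in> {- \<lfloor>R\<rfloor>..\<lfloor>R\<rfloor>}" using R by (intro abs_coord_le_norm_lattice_vec)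
    moreover have "0 < q" using q0 k by auto
    ultimately show "enc k $ l \<in> S l" by (auto simp: enc_def S_def)
  qed
  then have "card (enc ` ?C) \<le> card {u :: int^'n. \<forall>l. u $ l \<in> S l}"
    by (intro card_mono finite_vec_box fin)
  also have "\<dots> = (\<Prod>l\<in>UNIV. card (S l))" by (rule card_vec_box)
  also have "\<dots> = card (S i) * (card (S j) * (\<Prod>l\<in>UNIV - {i} - {j}. card (S l)))"
    using ij by (simp add: prod.remove[of UNIV i] prod.remove[of "UNIV - {i}" j])
  also have "(\<Prod>l\<in>UNIV - {i} - {j}. card (S l)) = (\<Prod>l\<in>UNIV - {i} - {j}. nat (2 * \<lfloor>R\<rfloor> + 1))"
    by (intro prod.cong) (auto simp: S_def)
  also have "\<dots> = nat (2 * \<lfloor>R\<rfloor> + 1) ^ (CARD('n) - 2)"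
  proof -
    have "card (UNIV - {i} - {j}) = CARD('n) - 1 - 1"
      using ij by (subst card_Diff_singleton) (simp_all add: card_Diff_singleton)
    also have "\<dots> = CARD('n) - 2" by linarith
    finally show ?thesis by (simp only: prod_constant)
  qed
  finally have "card ?C \<le> q * nat (2 * \<lfloor>R\<rfloor> + 1) ^ (CARD('n) - 2)"
    using inj ij by (simp add: card_image S_def)
  then have "real (card ?C) \<le> real (q * nat (2 * \<lfloor>R\<rfloor> + 1) ^ (CARD('n) - 2))"
    by (rule of_nat_mono)
  also have "\<dots> = real q * real (nat (2 * \<lfloor>R\<rfloor> + 1)) ^ (CARD('n) - 2)"
    by (simp only: of_nat_mult of_nat_power)
  also have "\<dots> \<le> real q * (2 * R + 1) ^ (CARD('n) - 2)"
  proof (intro mult_left_mono power_mono)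
    have "real_of_int \<lfloor>R\<rfloor> \<le> R" "0 \<le> \<lfloor>R\<rfloor>" using R by auto
    then show "real (nat (2 * \<lfloor>R\<rfloor> + 1)) \<le> 2 * R + 1" by simp
  qed auto
  finally show ?thesis .
qed

text \<open>The midpoint v = k + m/2 of \<open>k\<close> and \<open>k + m\<close> is orthogonal to
  \<open>m\<close>, and |v|^2 = |k|^2 - |m|^2 / 4 is at least 3/4 of \<open>A\<close> as long as
  |m|^2 \<le> A. Such a long vector in the hyperplane has at least one slope \<open>p j k\<close> of
  size \<delta>, so the classes of the previous lemma, indexed by \<open>j\<close> and a sign, cover
  the whole section.\<close>

lemma card_shell_hyperplane:
  fixes m :: "int^'n::finite" and A L R \<delta> :: real and q :: nat
  defines "H \<equiv> {k. A \<le> (norm (lattice_vec k :: real^'n))\<^sup>2 \<and> (norm (lattice_vec k :: real^'n))\<^sup>2 \<le> A + L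
      \<and> (norm (lattice_vec (k + m) :: real^'n))\<^sup>2 = (norm (lattice_vec k :: real^'n))\<^sup>2}"
  assumes m: "m \<noteq> 0" and mA: "(norm (lattice_vec m :: real^'n))\<^sup>2 \<le> A"
    and R: "0 \<le> R" "A + L \<le> R\<^sup>2" and \<delta>: "0 < \<delta>" "(\<delta> * real CARD('n))\<^sup>2 \<le> 3 / 4 * A"
    and q: "L < 2 * \<delta> * real q"
  shows "real (card H) \<le> 2 * real CARD('n) * real q * (2 * R + 1) ^ (CARD('n) - 2)"
proof -
  let ?v = "lattice_vec :: int^'n \<Rightarrow> real^'n"
  let ?d = "real CARD('n)"
  obtain i where mi: "m $ i \<noteq> 0" using m by (auto simp: vec_eq_iff)
  define p where "p j k = (of_int (k $ j) - of_int (m $ j) / of_int (m $ i) * of_int (k $ i) :: real)" for j k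
  define C where "C = (\<lambda>(j, \<sigma>). {k \<in> H. \<delta> \<le> \<sigma> * p j k})"
  have finH: "finite H"
    by (rule finite_subset[OF _ finite_lattice_ball[of "A + L"]]) (auto simp: H_def)
  have d: "0 < ?d" by simp
  have cover: "H \<subseteq> (\<Union>z\<in>(UNIV - {i}) \<times> {1, -1}. C z)"
  proof
    fix k assume k: "k \<in> H"
    define v where "v = ?v k + (1/2) *\<^sub>R ?v m"
    have *: "2 * (?v k \<bullet> ?v m) + ?v m \<bullet> ?v m = 0"
      using k by (simp add: H_def power2_norm_eq_inner lattice_vec_add algebra_simps inner_commute)
    then have orth: "v \<bullet> ?v m = 0" by (simp add: v_def inner_add_left)
    have "v \<bullet> v = ?v k \<bullet> ?v k - ?v m \<bullet> ?v m / 4"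
      using * by (simp add: v_def inner_add_left inner_add_right inner_commute)
    moreover have "A \<le> ?v k \<bullet> ?v k" "?v m \<bullet> ?v m \<le> A"
      using k mA by (simp_all add: H_def power2_norm_eq_inner)
    ultimately have "(\<delta> * ?d)\<^sup>2 \<le> (norm v)\<^sup>2"
      using \<delta>(2) by (simp add: power2_norm_eq_inner)
    then have nv: "\<delta> * ?d \<le> norm v" using \<delta>(1) d by (simp add: power2_le_iff_abs_le)
    have pv: "p j k = v $ j - of_int (m $ j) / of_int (m $ i) * v $ i" for j
      using mi by (simp add: p_def v_def field_simps)
    \<comment> \<open>Since \<open>v\<close> is orthogonal to \<open>m\<close>, it is the combination \<open>\<Sum>j. v\<^sub>j w\<^sub>j\<close> of the vectors
      \<open>w\<^sub>j = e\<^sub>j - (m\<^sub>j / m\<^sub>i) e\<^sub>i\<close>, and \<open>p j k = v \<bullet> w\<^sub>j\<close>.\<close>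
    have "(\<Sum>j\<in>UNIV. v $ j * p j k) = v \<bullet> v - v $ i / of_int (m $ i) * (v \<bullet> ?v m)"
      by (simp add: pv inner_vec_def sum_distrib_left right_diff_distrib sum_subtractf mult_ac)
    then have vv: "(\<Sum>j\<in>UNIV. v $ j * p j k) = (norm v)\<^sup>2"
      using orth by (simp add: power2_norm_eq_inner)
    \<comment> \<open>If all slopes were smaller than \<delta>, then |v|^2 = \<Sum> v_j p_j < d
      \<delta> |v| \<le> |v|^2.\<close>
    have "\<exists>j. \<delta> \<le> \<bar>p j k\<bar>"
    proof (rule ccontr)
      assume "\<not> ?thesis"
      then have small: "\<bar>p j k\<bar> < \<delta>" for j by (simp add: not_le)
      have pos: "0 < norm v" using nv \<delta>(1) d by (smt (verit) mult_pos_pos)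
      have "(\<Sum>j\<in>UNIV. v $ j * p j k) < (\<Sum>j\<in>(UNIV::'n set). norm v * \<delta>)"
      proof (rule sum_strict_mono)
        fix j
        have "v $ j * p j k \<le> \<bar>v $ j\<bar> * \<bar>p j k\<bar>" by (metis abs_ge_self abs_mult)
        also have "\<dots> \<le> norm v * \<bar>p j k\<bar>"
          by (intro mult_right_mono component_le_norm_cart) auto
        also have "\<dots> < norm v * \<delta>" using small pos by simp
        finally show "v $ j * p j k < norm v * \<delta>" .
      qed auto
      also have "\<dots> = norm v * (\<delta> * ?d)" by simp
      also have "\<dots> \<le> norm v * norm v" using nv by (intro mult_left_mono) auto
      finally show False using vv by (simp add: power2_eq_square)
    qed
    then obtain j where j: "\<delta> \<le> \<bar>p j k\<bar>" by blast
    \<comment> \<open>The slope \<open>p i k\<close> is 0 by its formula.\<close>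
    have "j \<noteq> i" using j \<delta>(1) mi by (auto simp: p_def)
    moreover have "\<delta> \<le> 1 * p j k \<or> \<delta> \<le> (-1) * p j k" using j by (simp add: abs_if split: if_splits)
    ultimately show "k \<in> (\<Union>z\<in>(UNIV - {i}) \<times> {1, -1}. C z)"
      using k unfolding C_def by blast
  qed
  have "real (card H) \<le> real (card (\<Union>z\<in>(UNIV - {i}) \<times> {1::real, -1}. C z))"
    using cover by (intro of_nat_mono card_mono) (auto simp: C_def finH)
  also have "\<dots> \<le> (\<Sum>z\<in>(UNIV - {i}) \<times> {1::real, -1}. real (card (C z)))"
    by (subst of_nat_sum[symmetric], intro of_nat_mono card_UN_le) simp
  also have "\<dots> \<le> (\<Sum>z\<in>(UNIV - {i}) \<times> {1::real, -1}. real q * (2 * R + 1) ^ (CARD('n) - 2))"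
  proof (intro sum_mono)
    fix z assume "z \<in> (UNIV - {i}) \<times> {1::real, -1}"
    then have "i \<noteq> fst z" "(snd z)\<^sup>2 = 1" by auto
    then obtain j \<sigma> where z: "z = (j, \<sigma>)" "i \<noteq> j" "\<sigma>\<^sup>2 = 1" by (cases z) auto
    show "real (card (C z)) \<le> real q * (2 * R + 1) ^ (CARD('n) - 2)"
      using card_shell_hyperplane_class[OF mi z(2) R \<delta>(1) q z(3)]
      by (simp add: C_def z(1) p_def H_def)
  qed
  also have "\<dots> = real (card ((UNIV - {i}) \<times> {1::real, -1})) * (real q * (2 * R + 1) ^ (CARD('n) - 2))"
    by (rule sum_constant)
  also have "\<dots> \<le> (?d * 2) * (real q * (2 * R + 1) ^ (CARD('n) - 2))"
  proof (rule mult_right_mono)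
    have "card (UNIV - {i}) * 2 \<le> CARD('n) * 2" by (rule mult_right_mono[OF card_mono]) auto
    then have "real (card (UNIV - {i}) * 2) \<le> real (CARD('n) * 2)" by (rule of_nat_mono)
    then show "real (card ((UNIV - {i}) \<times> {1::real, -1})) \<le> ?d * 2"
      unfolding card_cartesian_product by simp
    show "0 \<le> real q * (2 * R + 1) ^ (CARD('n) - 2)" using R by simp
  qed
  finally show ?thesis by (simp add: mult_ac)
qed

text \<open>All coordinates but one range freely over [(1 - \<eta>) u, u]. Since (d - 1) u^2 = A,
  their squares sum to at most \<open>A\<close> and leave a gap of at most 2 \<eta> A, which the
  last coordinate fills. Rounding its square root r up overshoots |k|^2 = A by at most 2 r + 1, and
  this has to fit into the thickness \<open>L\<close>.\<close>

lemma card_shell_lower: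
  fixes A L \<eta> :: real
  defines "u \<equiv> sqrt (A / (real CARD('n::finite) - 1))"
  assumes d: "2 \<le> CARD('n)" and A: "0 < A" and \<eta>: "0 < \<eta>" "\<eta> < 1"
    and L: "2 * sqrt (2 * \<eta> * A) + 1 \<le> L" and u: "2 \<le> \<eta> * u"
  shows "(\<eta> * u / 2) ^ (CARD('n) - 1) \<le>
    real (card {k :: int^'n. A \<le> (norm (lattice_vec k :: real^'n))\<^sup>2 \<and> (norm (lattice_vec k :: real^'n))\<^sup>2 \<le> A + L})"
    (is "_ \<le> real (card ?H)")
proof -
  obtain i :: 'n where True by blast
  \<comment> \<open>Coordinate \<open>i\<close> is a placeholder: it is fixed to 0, so that
    \<open>X\<close> counts the free coordinates only, and \<open>g\<close> overwrites it.\<close>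
  define S where "S l = (if l = i then {0} else {\<lceil>(1 - \<eta>) * u\<rceil>..\<lfloor>u\<rfloor>})" for l
  define X where "X = {x :: int^'n. \<forall>l. x $ l \<in> S l}"
  define b where "b x = (\<Sum>l\<in>UNIV - {i}. (real_of_int (x $ l))\<^sup>2)" for x :: "int^'n"
  define g :: "int^'n \<Rightarrow> int^'n" where "g x = (\<chi> l. if l = i then \<lceil>sqrt (A - b x)\<rceil> else x $ l)" for x
  have d1: "0 < real CARD('n) - 1" using d by linarith
  have u0: "0 \<le> u" using A d1 by (simp add: u_def)
  have "u\<^sup>2 = A / (real CARD('n) - 1)"
    unfolding u_def using A d1 by (intro real_sqrt_pow2) simp
  then have uu: "(real CARD('n) - 1) * u\<^sup>2 = A" using d1 by simp
  have inj: "inj_on g X"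
  proof (rule inj_onI)
    fix x y assume "x \<in> X" "y \<in> X" and eq: "g x = g y"
    have "x $ l = y $ l" for l
    proof (cases "l = i")
      case True
      then show ?thesis using \<open>x \<in> X\<close> \<open>y \<in> X\<close> by (auto simp: X_def S_def dest!: spec[of _ i])
    next
      case False
      then show ?thesis using arg_cong[OF eq, of "\<lambda>z. z $ l"] by (simp add: g_def)
    qed
    then show "x = y" by (simp add: vec_eq_iff)
  qed
  have cardm: "real (card (UNIV - {i})) = real CARD('n) - 1"
    using d by (simp add: card_Diff_subset of_nat_diff)
  have img: "g ` X \<subseteq> ?H"
  proof
    fix k assume "k \<in> g ` X"
    then obtain x where x: "x \<in> X" and k: "k = g x" by blast
    have xl: "(1 - \<eta>) * u \<le> real_of_int (x $ l)" "real_of_int (x $ l) \<le> u" if "l \<noteq> i" for l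
    proof -
      have "x $ l \<in> S l" using x by (auto simp: X_def)
      then show "(1 - \<eta>) * u \<le> real_of_int (x $ l)" "real_of_int (x $ l) \<le> u"
        using that by (auto simp: S_def ceiling_le_iff le_floor_iff)
    qed
    have nn: "0 \<le> (1 - \<eta>) * u" using \<eta> u0 by simp
    have xnn: "0 \<le> x $ l" if "l \<noteq> i" for l
      using xl(1)[OF that] nn by linarith
    have "b x \<le> (\<Sum>l\<in>UNIV - {i}. u\<^sup>2)"
      unfolding b_def using xl xnn by (intro sum_mono power_mono) auto
    also have "\<dots> = A" using uu cardm by simp
    finally have b1: "b x \<le> A" .
    have "(\<Sum>l\<in>UNIV - {i}. ((1 - \<eta>) * u)\<^sup>2) \<le> b x"
      unfolding b_def using xl nn by (intro sum_mono power_mono) auto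
    also have "(\<Sum>l\<in>UNIV - {i}. ((1 - \<eta>) * u)\<^sup>2) = (1 - \<eta>)\<^sup>2 * A"
      using uu cardm by (simp add: power_mult_distrib)
    finally have "A - b x \<le> (1 - (1 - \<eta>)\<^sup>2) * A" by (simp add: algebra_simps)
    also have "\<dots> \<le> 2 * \<eta> * A" using A by (intro mult_right_mono) (auto simp: power2_eq_square algebra_simps)
    finally have b2: "A - b x \<le> 2 * \<eta> * A" .
    define r where "r = sqrt (A - b x)"
    have r: "0 \<le> r" "r\<^sup>2 = A - b x" "2 * r + 1 \<le> L"
    proof -
      show "0 \<le> r" "r\<^sup>2 = A - b x" using b1 by (simp_all add: r_def)
      have "r \<le> sqrt (2 * \<eta> * A)" unfolding r_def using b2 by simp
      with L show "2 * r + 1 \<le> L" by linarith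
    qed
    have c: "r \<le> of_int \<lceil>r\<rceil>" "of_int \<lceil>r\<rceil> \<le> r + 1" by linarith+
    have "r\<^sup>2 \<le> (of_int \<lceil>r\<rceil>)\<^sup>2" using c r by (intro power_mono) auto
    moreover have "(of_int \<lceil>r\<rceil>)\<^sup>2 \<le> (r + 1)\<^sup>2" using c r by (intro power_mono) auto
    moreover have "(r + 1)\<^sup>2 = r\<^sup>2 + (2 * r + 1)" by (simp add: power2_sum)
    moreover have "(norm (lattice_vec k :: real^'n))\<^sup>2 = (of_int \<lceil>r\<rceil>)\<^sup>2 + b x"
      by (simp add: norm_sq_vec k g_def b_def r_def sum.remove[of UNIV i])
    ultimately show "k \<in> ?H" using r by auto
  qed
  have "(\<eta> * u / 2) ^ (CARD('n) - 1) = (\<Prod>l\<in>UNIV - {i}. \<eta> * u / 2)"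
    by (simp add: card_Diff_subset)
  also have "\<dots> \<le> (\<Prod>l\<in>UNIV - {i}. real (card (S l)))"
  proof (intro prod_mono conjI)
    fix l assume "l \<in> UNIV - {i}"
    then have "real (card (S l)) = real (nat (\<lfloor>u\<rfloor> - \<lceil>(1 - \<eta>) * u\<rceil> + 1))"
      by (simp add: S_def)
    \<comment> \<open>An interval of length \<eta> * u contains at least \<eta> * u - 1 integers,
      and this is at least half of \<eta> * u since \<eta> * u \<ge> 2.\<close>
    moreover have "\<eta> * u - 1 \<le> real_of_int (\<lfloor>u\<rfloor> - \<lceil>(1 - \<eta>) * u\<rceil> + 1)"
    proof -
      have "(1 - \<eta>) * u = u - \<eta> * u" by (simp add: algebra_simps)
      then show ?thesis by linarith
    qed
    ultimately show "\<eta> * u / 2 \<le> real (card (S l))" using u by linarith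
    show "0 \<le> \<eta> * u / 2" using u by simp
  qed
  also have "\<dots> = real (\<Prod>l\<in>UNIV. card (S l))"
    by (simp add: prod.remove[of UNIV i] S_def)
  also have "\<dots> = real (card X)" by (simp add: X_def card_vec_box)
  also have "\<dots> = real (card (g ` X))" using inj by (simp add: card_image)
  also have "\<dots> \<le> real (card ?H)"
    by (intro of_nat_mono card_mono img finite_subset[OF _ finite_lattice_ball[of "A + L"]]) auto
  finally show ?thesis .
qed

section \<open>Characters and Fourier coefficients\<close>

definition character :: "int^'n::finite \<Rightarrow> real^'n \<Rightarrow> complex" where
  "character k x = cis (2 * pi * (lattice_vec k \<bullet> x))"

lemma character_add: "character (k + l) x = character k x * character l x"
  by (simp add: character_def lattice_vec_add cis_mult algebra_simps)

lemma character_0 [simp]: "character 0 x = 1"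
  by (simp add: character_def)

lemma character_uminus: "character (- k) x = cnj (character k x)"
  by (simp add: character_def lattice_vec_uminus cis_cnj)

lemma norm_character [simp]: "cmod (character k x) = 1"
  by (simp add: character_def)

lemma character_nonzero [simp]: "character k x \<noteq> 0"
  by (simp add: character_def)

lemma periodic_character:
  fixes k :: "int^'n::finite"
  shows "periodic (character k)"
proof -
  have "(lattice_vec k :: real^'n) \<bullet> lattice_vec l = of_int (\<Sum>i\<in>UNIV. k $ i * l $ i)" for l :: "int^'n"
    by (simp add: inner_vec_def)
  then have "cis (2 * pi * ((lattice_vec k :: real^'n) \<bullet> lattice_vec l)) = 1" for l :: "int^'n"
    by (metis Ints_of_int cis_multiple_2pi)
  then show ?thesis
    by (simp add: periodic_def character_def inner_add_right distrib_left flip: cis_mult)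
qed

lemma differentiable_character: "character k differentiable (at x)"
proof -
  have "character k = (\<lambda>x. of_real (cos (2 * pi * (lattice_vec k \<bullet> x))) +
      \<i> * of_real (sin (2 * pi * (lattice_vec k \<bullet> x))))"
    by (auto simp: character_def complex_eq_iff)
  moreover have "\<dots> differentiable (at x)"
    unfolding differentiable_def by (rule exI) (auto intro!: derivative_eq_intros)
  ultimately show ?thesis by simp
qed

lemma continuous_differentiable:
  assumes "\<And>x. f differentiable (at x)"
  shows "continuous_on UNIV f"
  using assms by (simp add: continuous_at_imp_continuous_on differentiable_imp_continuous_within)

lemma continuous_character: "continuous_on UNIV (character k)"
  by (intro continuous_differentiable differentiable_character)

lemma continuous_character_compose [continuous_intros]: "continuous_on S (\<lambda>x. character k x)"
  using continuous_character continuous_on_subset by blast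

lemma partial_mult_character:
  assumes "\<And>x. f differentiable (at x)"
  shows "partial i (\<lambda>x. f x * character k x) x =
    partial i f x * character k x + 2 * pi * \<i> * of_int (k $ i) * (f x * character k x)"
proof (rule partial_eqI)
  have 1: "((\<lambda>t. f (x + t *\<^sub>R axis i 1)) has_vector_derivative partial i f x) (at 0)"
    using has_vector_derivative_partial[OF assms, of x i 0] by simp
  have c: "character k (x + t *\<^sub>R axis i 1) = character k x * cis (t * (2 * pi * of_int (k $ i)))" for t
    by (simp add: character_def inner_add_right inner_axis cis_mult algebra_simps)
  have "((\<lambda>t. cis (t * (2 * pi * of_int (k $ i)))) has_vector_derivative
      of_real (2 * pi * of_int (k $ i)) * \<i>) (at 0)"
    unfolding has_vector_derivative_complex_iff by (auto intro!: derivative_eq_intros)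
  then have 2: "((\<lambda>t. character k (x + t *\<^sub>R axis i 1)) has_vector_derivative
      character k x * (of_real (2 * pi * of_int (k $ i)) * \<i>)) (at 0)"
    unfolding c by (rule has_vector_derivative_mult_right)
  show "((\<lambda>t. f (x + t *\<^sub>R axis i 1) * character k (x + t *\<^sub>R axis i 1)) has_vector_derivative
      partial i f x * character k x + 2 * pi * \<i> * of_int (k $ i) * (f x * character k x)) (at 0)"
    using has_vector_derivative_mult[OF 1 2] by (simp add: algebra_simps)
qed

lemma partial_character: "partial i (character k) = (\<lambda>x. 2 * pi * \<i> * of_int (k $ i) * character k x)"
proof
  fix x
  have "partial i (\<lambda>_. 1) x = 0" by (simp add: partial_def)
  then show "partial i (character k) x = 2 * pi * \<i> * of_int (k $ i) * character k x"
    using partial_mult_character[of "\<lambda>_. 1" i k x] by simp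
qed

lemma partial_cmult:
  assumes "\<And>x. f differentiable (at x)"
  shows "partial i (\<lambda>x. c * f x) = (\<lambda>x. c * partial i f x)"
proof
  fix x
  have 1: "((\<lambda>t. f (x + t *\<^sub>R axis i 1)) has_vector_derivative partial i f x) (at 0)"
    using has_vector_derivative_partial[OF assms, of x i 0] by simp
  show "partial i (\<lambda>x. c * f x) x = c * partial i f x"
    by (rule partial_eqI) (rule has_vector_derivative_mult_right[OF 1])
qed

text \<open>Every iterated partial derivative of a character is a scalar multiple of it, so one
  differentiability statement covers all orders.\<close>

lemma torus_smooth_character: "torus_smooth (character k)"
proof -
  have "\<exists>c. partials l (character k) = (\<lambda>x. c * character k x)" for l
  proof (induction l)
    case Nil
    show ?case by (rule exI[of _ 1]) (simp add: partials_def)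
  next
    case (Cons i l)
    then obtain c where c: "partials l (character k) = (\<lambda>x. c * character k x)" by blast
    have "partials (i # l) (character k) = partial i (partials l (character k))"
      by (simp add: partials_def)
    also have "\<dots> = (\<lambda>x. (c * (2 * pi * \<i> * of_int (k $ i))) * character k x)"
      unfolding c partial_cmult[OF differentiable_character] partial_character
      by (simp only: mult.assoc)
    finally show ?case by blast
  qed
  moreover have "(\<lambda>x. c * character k x) differentiable (at x)" for c x
    by (intro differentiable_mult differentiable_const differentiable_character)
  ultimately have "partials l (character k) differentiable (at x)" for l x
    by metis
  then show ?thesis by (simp add: torus_smooth_def smooth_def periodic_character)
qed

lemma torus_smooth_differentiable:
  assumes "torus_smooth f"
  shows "f differentiable (at x)"
proof -
  have "partials [] f differentiable (at x)"
    using assms unfolding torus_smooth_def smooth_def by blast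
  then show ?thesis by (simp add: partials_def)
qed

lemma torus_smooth_continuous: "torus_smooth f \<Longrightarrow> continuous_on UNIV f"
  by (simp add: continuous_differentiable torus_smooth_differentiable)

lemma torus_smooth_partial:
  assumes "torus_smooth f"
  shows "torus_smooth (partial i f)"
proof -
  have "partials l (partial i f) = partials (l @ [i]) f" for l
    by (simp add: partials_def)
  moreover have "periodic (partial i f)"
    using assms by (auto simp: torus_smooth_def periodic_def partial_def add.commute add.left_commute)
      (metis add.assoc add.commute)
  ultimately show ?thesis
    using assms by (simp add: torus_smooth_def smooth_def)
qed

section \<open>Rules for Fourier coefficients\<close>

lemma fourier_coeff_character: "fourier_coeff f k = torus_integral (\<lambda>x. f x * character (- k) x)"
  by (simp add: fourier_coeff_def character_def lattice_vec_uminus)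

lemma fourier_coeff_mult_character:
  "fourier_coeff (\<lambda>x. f x * character l x) k = fourier_coeff f (k - l)"
proof -
  have "(\<lambda>x. f x * character l x * character (- k) x) = (\<lambda>x. f x * character (- (k - l)) x)"
    by (simp add: mult.assoc flip: character_add)
  then show ?thesis by (simp add: fourier_coeff_character)
qed

lemma fourier_coeff_add:
  assumes "continuous_on UNIV f" "continuous_on UNIV g"
  shows "fourier_coeff (\<lambda>x. f x + g x) k = fourier_coeff f k + fourier_coeff g k"
  using torus_integral_add[of "\<lambda>x. f x * character (- k) x" "\<lambda>x. g x * character (- k) x"] assms
  by (simp add: fourier_coeff_character algebra_simps continuous_intros)

lemma fourier_coeff_diff:
  assumes "continuous_on UNIV f" "continuous_on UNIV g"
  shows "fourier_coeff (\<lambda>x. f x - g x) k = fourier_coeff f k - fourier_coeff g k"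
  using torus_integral_diff[of "\<lambda>x. f x * character (- k) x" "\<lambda>x. g x * character (- k) x"] assms
  by (simp add: fourier_coeff_character algebra_simps continuous_intros)

lemma fourier_coeff_sum:
  assumes "finite S" "\<And>i. i \<in> S \<Longrightarrow> continuous_on UNIV (f i)"
  shows "fourier_coeff (\<lambda>x. \<Sum>i\<in>S. f i x) k = (\<Sum>i\<in>S. fourier_coeff (f i) k)"
  using torus_integral_sum[of S "\<lambda>i x. f i x * character (- k) x"] assms
  by (simp add: fourier_coeff_character sum_distrib_right continuous_intros)

lemma fourier_coeff_cmult:
  assumes "continuous_on UNIV f"
  shows "fourier_coeff (\<lambda>x. c * f x) k = c * fourier_coeff f k"
  using torus_integral_cmult[of "\<lambda>x. f x * character (- k) x" c] assms
  by (simp add: fourier_coeff_character mult.assoc continuous_intros)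

text \<open>Integration by parts: the derivative of the periodic product of \<open>f\<close> with
  \<open>character (- k)\<close> has integral zero.\<close>

lemma fourier_coeff_partial:
  assumes "torus_smooth f"
  shows "fourier_coeff (partial i f) k = 2 * pi * \<i> * of_int (k $ i) * fourier_coeff f k"
proof -
  let ?g = "\<lambda>x. f x * character (- k) x"
  note diff = torus_smooth_differentiable[OF assms]
  note cont = torus_smooth_continuous[OF assms] torus_smooth_continuous[OF torus_smooth_partial[OF assms]]
  have p: "partial i ?g = (\<lambda>x. partial i f x * character (- k) x - 2 * pi * \<i> * of_int (k $ i) * ?g x)"
    using partial_mult_character[OF diff, of i "- k"] by auto
  have "torus_integral (partial i ?g) = 0"
  proof (rule integral_partial_zero)
    show "?g differentiable (at x)" for x
      by (intro differentiable_mult diff differentiable_character)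
    show "continuous_on UNIV (partial i ?g)"
      unfolding p using cont by (intro continuous_intros)
    show "periodic ?g"
      using assms periodic_character[of "- k"] by (simp add: torus_smooth_def periodic_def)
  qed
  also have "torus_integral (partial i ?g) =
      torus_integral (\<lambda>x. partial i f x * character (- k) x) -
      torus_integral (\<lambda>x. 2 * pi * \<i> * of_int (k $ i) * ?g x)"
    unfolding p using cont by (intro torus_integral_diff continuous_intros)
  also have "torus_integral (\<lambda>x. 2 * pi * \<i> * of_int (k $ i) * ?g x) =
      2 * pi * \<i> * of_int (k $ i) * torus_integral ?g"
    using cont by (intro torus_integral_cmult continuous_intros)
  finally show ?thesis by (simp add: fourier_coeff_character)
qed

text \<open>If k_i is nonzero, the character is a multiple of its own derivative in direction
  \<open>i\<close>, whose integral vanishes.\<close>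

lemma torus_integral_character: "torus_integral (character k) = (if k = 0 then 1 else 0)"
proof (cases "k = 0")
  case True
  then have "character k = (\<lambda>_. 1)" by auto
  then show ?thesis using True by (simp add: torus_integral_const)
next
  case False
  then obtain i where i: "k $ i \<noteq> 0" by (auto simp: vec_eq_iff)
  have "torus_integral (partial i (character k)) = 0"
    by (intro integral_partial_zero differentiable_character periodic_character)
      (simp add: partial_character continuous_intros)
  also have "torus_integral (partial i (character k)) =
      2 * pi * \<i> * of_int (k $ i) * torus_integral (character k)"
    unfolding partial_character by (rule torus_integral_cmult) (rule continuous_character)
  finally show ?thesis using i False by simp
qed

lemma fourier_coeff_of_character: "fourier_coeff (character l) k = (if l = k then 1 else 0)"
  using torus_integral_character[of "l - k"]
  by (simp add: fourier_coeff_character flip: character_add)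

text \<open>Multiplication by \<open>a\<close> in the basis of characters: its entries depend only
  on the difference of the frequencies. The case a = 1 yields orthonormality, and a single frequency
  0 on one side yields the pairing needed for Bessel's inequality.\<close>

lemma torus_integral_trig_form:
  fixes a :: "real^'n::finite \<Rightarrow> complex" and c d :: "int^'n \<Rightarrow> complex"
  assumes a: "continuous_on UNIV a" and F: "finite F" "finite G"
  shows "torus_integral (\<lambda>x. a x * (\<Sum>k\<in>F. c k * character k x) * cnj (\<Sum>l\<in>G. d l * character l x)) =
    (\<Sum>k\<in>F. \<Sum>l\<in>G. c k * cnj (d l) * fourier_coeff a (l - k))"
proof -
  have "a x * (\<Sum>k\<in>F. c k * character k x) * cnj (\<Sum>l\<in>G. d l * character l x) =
      (\<Sum>k\<in>F. \<Sum>l\<in>G. c k * cnj (d l) * (a x * character (- (l - k)) x))" for x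
  proof -
    have *: "character (- (l - k)) x = character k x * cnj (character l x)" for k l
      using character_add[of k "- l" x] by (simp add: character_uminus)
    have "a x * (\<Sum>k\<in>F. c k * character k x) * cnj (\<Sum>l\<in>G. d l * character l x) =
        (\<Sum>k\<in>F. a x * (c k * character k x)) * (\<Sum>l\<in>G. cnj (d l * character l x))"
      by (simp only: sum_distrib_left cnj_sum)
    also have "\<dots> = (\<Sum>k\<in>F. \<Sum>l\<in>G. a x * (c k * character k x) * cnj (d l * character l x))"
      by (rule sum_product)
    also have "\<dots> = (\<Sum>k\<in>F. \<Sum>l\<in>G. c k * cnj (d l) * (a x * character (- (l - k)) x))"
      unfolding * by (intro sum.cong refl) (simp only: complex_cnj_mult mult_ac)
    finally show ?thesis .
  qed
  then have "torus_integral (\<lambda>x. a x * (\<Sum>k\<in>F. c k * character k x) * cnj (\<Sum>l\<in>G. d l * character l x)) =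
      torus_integral (\<lambda>x. \<Sum>k\<in>F. \<Sum>l\<in>G. c k * cnj (d l) * (a x * character (- (l - k)) x))"
    by simp
  also have "\<dots> = (\<Sum>k\<in>F. \<Sum>l\<in>G. c k * cnj (d l) * torus_integral (\<lambda>x. a x * character (- (l - k)) x))"
    using a F by (subst torus_integral_sum, simp, intro continuous_intros, simp)+
      (subst torus_integral_cmult; auto intro!: continuous_intros)
  finally show ?thesis by (simp only: fourier_coeff_character)
qed

section \<open>Orthonormality of characters and Bessel's inequality\<close>

lemma fourier_coeff_one: "fourier_coeff (\<lambda>_. 1) k = (if k = 0 then 1 else 0)"
  using fourier_coeff_of_character[of 0 k] by (auto simp: character_0[abs_def])

lemma L2_inner_trig:
  assumes "finite F"
  shows "L2_inner (\<lambda>x. \<Sum>k\<in>F. c k * character k x) (\<lambda>x. \<Sum>k\<in>F. d k * character k x) =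
    (\<Sum>k\<in>F. c k * cnj (d k))"
proof -
  have "L2_inner (\<lambda>x. \<Sum>k\<in>F. c k * character k x) (\<lambda>x. \<Sum>k\<in>F. d k * character k x) =
      (\<Sum>k\<in>F. \<Sum>l\<in>F. c k * cnj (d l) * fourier_coeff (\<lambda>_. 1) (l - k))"
    using torus_integral_trig_form[of "\<lambda>_. 1" F F c d] assms by (simp add: L2_inner_def)
  also have "\<dots> = (\<Sum>k\<in>F. \<Sum>l\<in>F. if l = k then c k * cnj (d l) else 0)"
    by (intro sum.cong) (auto simp: fourier_coeff_one)
  finally show ?thesis using assms by (simp add: sum.delta')
qed

lemma torus_integral_Re:
  fixes f :: "real^'n::finite \<Rightarrow> complex"
  assumes "continuous_on UNIV f"
  shows "torus_integral (\<lambda>x. Re (f x)) = Re (torus_integral f)"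
  using assms integral_linear[OF continuous_integrable_box[OF assms] bounded_linear_Re, of 0 1]
  by (simp add: torus_integral_HK continuous_intros o_def)

text \<open>Integrate the pointwise inequality 2 Re (f cnj S) - |S|^2 \<le> |f|^2, which is |f -
  S|^2 \<ge> 0, for the partial Fourier sum S. The integrals of f cnj S and of |S|^2 both equal the
  sum of squares.\<close>

lemma bessel:
  fixes f :: "real^'n::finite \<Rightarrow> complex"
  assumes f: "continuous_on UNIV f" and F: "finite F"
  shows "(\<Sum>k\<in>F. (cmod (fourier_coeff f k))\<^sup>2) \<le> (L2_norm f)\<^sup>2"
proof -
  define S where "S x = (\<Sum>k\<in>F. fourier_coeff f k * character k x)" for x
  have contS: "continuous_on UNIV S" unfolding S_def by (intro continuous_intros)
  let ?B = "\<Sum>k\<in>F. (cmod (fourier_coeff f k))\<^sup>2"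
  have "torus_integral (\<lambda>x. f x * cnj (S x)) =
      (\<Sum>l\<in>F. cnj (fourier_coeff f l) * fourier_coeff f l)"
    using torus_integral_trig_form[OF f _ F, of "{0}" "\<lambda>_. 1" "fourier_coeff f"]
    by (simp add: S_def)
  also have "\<dots> = of_real ?B"
    by (simp add: mult.commute flip: complex_norm_square)
  finally have 1: "torus_integral (\<lambda>x. f x * cnj (S x)) = of_real ?B" .
  have 2: "torus_integral (\<lambda>x. S x * cnj (S x)) = of_real ?B"
    using L2_inner_trig[OF F, of "fourier_coeff f" "fourier_coeff f"]
    by (simp add: L2_inner_def S_def[abs_def] flip: complex_norm_square)
  have "torus_integral (\<lambda>x. 2 * (f x * cnj (S x)) - S x * cnj (S x)) =
      torus_integral (\<lambda>x. 2 * (f x * cnj (S x))) - torus_integral (\<lambda>x. S x * cnj (S x))"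
    using f contS by (intro torus_integral_diff continuous_intros)
  also have "torus_integral (\<lambda>x. 2 * (f x * cnj (S x))) = 2 * torus_integral (\<lambda>x. f x * cnj (S x))"
    using f contS by (intro torus_integral_cmult continuous_intros)
  finally have 3: "torus_integral (\<lambda>x. 2 * (f x * cnj (S x)) - S x * cnj (S x)) = of_real ?B"
    by (simp add: 1 2)
  have "torus_integral (\<lambda>x. Re (2 * (f x * cnj (S x)) - S x * cnj (S x))) \<le>
      torus_integral (\<lambda>x. (cmod (f x))\<^sup>2)"
  proof (rule torus_integral_mono)
    show "continuous_on UNIV (\<lambda>x. Re (2 * (f x * cnj (S x)) - S x * cnj (S x)))"
      "continuous_on UNIV (\<lambda>x. (cmod (f x))\<^sup>2)"
      using f contS by (auto intro!: continuous_intros)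
    fix x
    have "0 \<le> (cmod (f x - S x))\<^sup>2" by simp
    then show "Re (2 * (f x * cnj (S x)) - S x * cnj (S x)) \<le> (cmod (f x))\<^sup>2"
      by (simp only: cmod_power2 minus_complex.simps times_complex.simps complex_cnj)
        (simp add: power2_eq_square algebra_simps)
  qed
  also have "torus_integral (\<lambda>x. Re (2 * (f x * cnj (S x)) - S x * cnj (S x))) = ?B"
    using 3 f contS by (subst torus_integral_Re) (auto intro!: continuous_intros)
  also have "torus_integral (\<lambda>x. (cmod (f x))\<^sup>2) = (L2_norm f)\<^sup>2"
  \<comment> \<open>The integral is nonnegative, so squaring undoes the square root in
    \<open>L2_norm\<close>.\<close>
  proof -
    have "torus_integral (\<lambda>x::real^'n. 0::real) \<le> torus_integral (\<lambda>x. (cmod (f x))\<^sup>2)"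
      using f by (intro torus_integral_mono continuous_intros) auto
    then show ?thesis by (simp add: L2_norm_def torus_integral_const)
  qed
  finally show ?thesis .
qed

section \<open>Uniqueness of Fourier coefficients\<close>

text \<open>A trigonometric polynomial with values in \<open>[0, 1]\<close> that equals \<open>1\<close> only at \<open>y\<close> modulo the
  lattice, so that its powers concentrate at \<open>y\<close>.\<close>

definition bump :: "real^'n::finite \<Rightarrow> real^'n \<Rightarrow> real" where
  "bump y x = (\<Sum>i\<in>UNIV. (1 + cos (2 * pi * (x $ i - y $ i))) / 2) / real CARD('n)"

lemma bump_bounds: "0 \<le> bump y x" "bump y x \<le> 1"
proof -
  have "0 \<le> (1 + c) / 2 \<and> (1 + c) / 2 \<le> 1" if "- 1 \<le> c" "c \<le> 1" for c :: real
    using that by simp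
  then have t: "0 \<le> (1 + cos r) / 2" "(1 + cos r) / 2 \<le> 1" for r :: real
    using cos_ge_minus_one cos_le_one by blast+
  show "0 \<le> bump y x" unfolding bump_def by (intro divide_nonneg_nonneg sum_nonneg t) simp
  have "(\<Sum>i\<in>(UNIV::'a set). (1 + cos (2 * pi * (x $ i - y $ i))) / 2) \<le> (\<Sum>i\<in>(UNIV::'a set). 1)"
    by (intro sum_mono t)
  then show "bump y x \<le> 1" unfolding bump_def by (simp add: divide_le_eq)
qed

lemma bump_self: "bump y y = 1"
  by (simp add: bump_def)

lemma continuous_bump: "continuous_on S (bump y)"
  unfolding bump_def by (intro continuous_intros) auto

text \<open>For \<open>y\<close> in the open cell and \<open>x\<close> in the closed one,
  coordinates differ by less than 1. This rules out that \<open>x\<close> is a translate of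
  \<open>y\<close> by a nonzero lattice vector, where the bump is 1 as well.\<close>

lemma bump_less_1:
  fixes x y :: "real^'n::finite"
  assumes x: "x \<in> cbox 0 1" and y: "y \<in> box 0 1" and "x \<noteq> y"
  shows "bump y x < 1"
proof -
  obtain i where i: "x $ i \<noteq> y $ i" using \<open>x \<noteq> y\<close> by (auto simp: vec_eq_iff)
  have "0 \<le> x $ i" "x $ i \<le> 1" "0 < y $ i" "y $ i < 1"
    using x y by (auto simp: mem_box_cart)
  then have lt: "\<bar>x $ i - y $ i\<bar> < 1" by linarith
  have "cos (2 * pi * (x $ i - y $ i)) \<noteq> 1"
  proof
    assume "cos (2 * pi * (x $ i - y $ i)) = 1"
    then obtain n :: int where "2 * pi * (x $ i - y $ i) = of_int n * 2 * pi"
      by (auto simp: cos_one_2pi_int)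
    then have n: "x $ i - y $ i = of_int n" by simp
    with lt have "n = 0" by linarith
    with n i show False by simp
  qed
  then have c: "cos (2 * pi * (x $ i - y $ i)) < 1" using cos_le_one less_le by blast
  have "(\<Sum>j\<in>(UNIV::'n set). (1 + cos (2 * pi * (x $ j - y $ j))) / 2) < (\<Sum>j\<in>(UNIV::'n set). 1)"
    by (rule sum_strict_mono_ex1) (use c in \<open>auto intro!: bexI[of _ i]\<close>)
  then show ?thesis unfolding bump_def by (simp add: divide_less_eq)
qed

lemma bump_expand:
  fixes x y :: "real^'n::finite"
  shows "complex_of_real (bump y x) = 1 / 2 + (\<Sum>i\<in>UNIV.
    (cis (- 2 * pi * y $ i) / (4 * CARD('n))) * character (axis i 1) x +
    (cis (2 * pi * y $ i) / (4 * CARD('n))) * character (- axis i 1) x)"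
proof -
  have e: "character (axis i 1) x = cis (2 * pi * x $ i)" for i
  proof -
    have "(lattice_vec (axis i 1) :: real^'n) = axis i 1"
      by (simp add: vec_eq_iff axis_def)
    then show ?thesis by (simp add: character_def inner_commute[of "axis i 1"] inner_axis)
  qed
  have c: "complex_of_real ((1 + cos (2 * pi * (x $ i - y $ i))) / 2) =
      1 / 2 + (cis (- 2 * pi * y $ i) * character (axis i 1) x + cis (2 * pi * y $ i) * character (- axis i 1) x) / 4" for i
  proof -
    have "cis (- 2 * pi * y $ i) * character (axis i 1) x = cis (2 * pi * (x $ i - y $ i))"
      "cis (2 * pi * y $ i) * character (- axis i 1) x = cis (- (2 * pi * (x $ i - y $ i)))"
      by (simp_all add: character_uminus e cis_cnj cis_mult algebra_simps)
    then show ?thesis by (simp only: complex_eq_iff) simp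
  qed
  have "complex_of_real (bump y x) =
      (\<Sum>i\<in>UNIV. complex_of_real ((1 + cos (2 * pi * (x $ i - y $ i))) / 2)) / of_nat CARD('n)"
    unfolding bump_def by (simp only: of_real_divide of_real_sum of_real_of_nat_eq)
  also have "\<dots> = 1 / 2 + (\<Sum>i\<in>UNIV.
    (cis (- 2 * pi * y $ i) * character (axis i 1) x + cis (2 * pi * y $ i) * character (- axis i 1) x) / 4)
     / of_nat CARD('n)"
    unfolding c by (simp add: sum.distrib add_divide_distrib)
  finally show ?thesis by (simp add: sum_divide_distrib add_divide_distrib)
qed

text \<open>The bump is a combination of characters, and multiplication by a character only shifts
  the coefficients. Vanishing of all of them is thus inherited by products with every power of the
  bump.\<close>

lemma fourier_coeff_mult_bump:
  fixes g :: "real^'n::finite \<Rightarrow> complex"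
  assumes g: "continuous_on UNIV g" and z: "\<And>k. fourier_coeff g k = 0"
  shows "fourier_coeff (\<lambda>x. g x * of_real (bump y x)) k = 0"
proof -
  define c d where "c i = cis (- 2 * pi * y $ i) / (4 * CARD('n))"
    and "d i = cis (2 * pi * y $ i) / (4 * CARD('n))" for i
  have "(\<lambda>x. g x * of_real (bump y x)) = (\<lambda>x. 1 / 2 * g x + (\<Sum>i\<in>UNIV.
     c i * (g x * character (axis i 1) x) + d i * (g x * character (- axis i 1) x)))"
    by (simp add: bump_expand c_def d_def distrib_left sum_distrib_left mult_ac)
  moreover have "fourier_coeff (\<lambda>x. g x / 2) k = 0"
    using fourier_coeff_cmult[OF g, of "1 / 2" k] by (simp add: z)
  ultimately show ?thesis
    using g by (simp add: fourier_coeff_add fourier_coeff_sum fourier_coeff_cmult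
        fourier_coeff_mult_character z continuous_intros)
qed

lemma integral_bump_power_zero:
  fixes g :: "real^'n::finite \<Rightarrow> complex"
  assumes g: "continuous_on UNIV g" and z: "\<And>k. fourier_coeff g k = 0"
  shows "torus_integral (\<lambda>x. g x * of_real (bump y x ^ n)) = 0"
proof -
  have cont: "continuous_on UNIV (\<lambda>x. g x * of_real (bump y x ^ n))" for n
    using g continuous_bump[of UNIV y] by (intro continuous_intros) auto
  have "fourier_coeff (\<lambda>x. g x * of_real (bump y x ^ n)) k = 0" for k
  proof (induction n arbitrary: k)
    case (Suc n)
    have "(\<lambda>x. g x * of_real (bump y x ^ Suc n)) = (\<lambda>x. (g x * of_real (bump y x ^ n)) * of_real (bump y x))"
      by (simp add: mult_ac)
    then show ?case using fourier_coeff_mult_bump[OF cont Suc] by simp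
  qed (use z in simp)
  then have "fourier_coeff (\<lambda>x. g x * of_real (bump y x ^ n)) 0 = 0" .
  then show ?thesis by (simp add: fourier_coeff_character)
qed

text \<open>Near \<open>y\<close> the integrand contributes at least c V r^n, away from
  \<open>y\<close> it is at least - M q^n with q < r. As the total is 0, c V \<le> M (q / r)^n for
  every n, which is impossible in the limit.\<close>

lemma bump_moments_nonzero:
  fixes g :: "real^'n::finite \<Rightarrow> real"
  assumes g: "continuous_on UNIV g" and y: "y \<in> box 0 1" and gy: "0 < g y"
    and z: "\<And>n. torus_integral (\<lambda>x. g x * bump y x ^ n) = 0"
  shows False
proof -
  define c where "c = g y / 2"
  have c: "0 < c" using gy by (simp add: c_def)
  have "open ({x. c < g x} \<inter> box 0 1)"
    using g by (intro open_Int open_box open_Collect_less continuous_on_const) auto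
  moreover have "y \<in> {x. c < g x} \<inter> box 0 1" using gy y by (simp add: c_def)
  ultimately obtain \<delta> where \<delta>: "0 < \<delta>" "ball y \<delta> \<subseteq> {x. c < g x} \<inter> box 0 1"
    by (meson open_contains_ball)
  define K where "K = cbox 0 1 - ball y \<delta>"
  have "compact K" unfolding K_def by (intro compact_diff) auto
  obtain q where q: "0 \<le> q" "q < 1" "\<And>x. x \<in> K \<Longrightarrow> bump y x \<le> q"
  proof (cases "K = {}")
    case True
    then show ?thesis using that[of 0] by simp
  next
    case False
    obtain x where x: "x \<in> K" "\<And>x'. x' \<in> K \<Longrightarrow> bump y x' \<le> bump y x"
      using continuous_attains_sup[OF \<open>compact K\<close> False continuous_bump] by blast
    have "bump y x < 1"
      using x(1) \<delta>(1) by (intro bump_less_1 y) (auto simp: K_def)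
    then show ?thesis using that[of "bump y x"] x bump_bounds by blast
  qed
  \<comment> \<open>A level strictly between \<open>q\<close> and 1 leaves a smaller ball around
    \<open>y\<close> on which the bump exceeds everything outside the larger ball by a fixed
    ratio.\<close>
  obtain r where r: "q < r" "r < 1" using q(2) dense by blast
  have "open ({x. r < bump y x} \<inter> ball y \<delta>)"
    by (intro open_Int open_ball open_Collect_less continuous_on_const continuous_bump)
  moreover have "y \<in> {x. r < bump y x} \<inter> ball y \<delta>" using r \<delta> by (simp add: bump_self)
  ultimately obtain \<epsilon> where \<epsilon>: "0 < \<epsilon>" "ball y \<epsilon> \<subseteq> {x. r < bump y x} \<inter> ball y \<delta>"
    by (meson open_contains_ball)
  obtain M where M: "\<And>x. x \<in> cbox 0 1 \<Longrightarrow> - M \<le> g x" "0 \<le> M"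
  proof -
    have "compact (g ` cbox 0 1)"
      using g continuous_on_subset by (intro compact_continuous_image) auto
    then have "bounded (g ` cbox 0 1)" by (rule compact_imp_bounded)
    then obtain M where M: "\<forall>x\<in>cbox 0 1. \<bar>g x\<bar> \<le> M" by (auto simp: bounded_iff)
    show ?thesis
    proof (rule that[of "\<bar>M\<bar>"])
      show "- \<bar>M\<bar> \<le> g x" if "x \<in> cbox 0 1" for x
        using bspec[OF M that] by linarith
    qed simp
  qed
  define V where "V = measure lborel (ball y \<epsilon>)"
  have V: "0 < V" unfolding V_def using \<epsilon>(1) by (rule content_ball_pos)
  have main: "c * V * r ^ n \<le> M * q ^ n" for n
  proof -
    have ind: "((\<lambda>x. if x \<in> ball y \<epsilon> then c * r ^ n else 0) has_integral (c * r ^ n * V)) (cbox 0 1)"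
    proof -
      have "ball y \<epsilon> \<subseteq> cbox 0 1"
        using \<epsilon>(2) \<delta>(2) box_subset_cbox[of 0 "1::real^'n"] by blast
      moreover have "((\<lambda>x. 1::real) has_integral V) (ball y \<epsilon>)"
        unfolding V_def by (intro has_integral_measure_lborel emeasure_lborel_ball_finite) auto
      then have "((\<lambda>x. c * r ^ n * 1) has_integral (c * r ^ n * V)) (ball y \<epsilon>)"
        by (rule has_integral_mult_right)
      ultimately show ?thesis
        using has_integral_restrict[of "ball y \<epsilon>" "cbox 0 1" "\<lambda>_. c * r ^ n"] by (simp del: mem_ball)
    qed
    have cst: "((\<lambda>x. M * q ^ n) has_integral (M * q ^ n)) (cbox 0 (1::real^'n))"
      using has_integral_const[of "M * q ^ n" 0 "1::real^'n"] by (simp add: content_unit_box)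
    have cont: "continuous_on UNIV (\<lambda>x. g x * bump y x ^ n)"
      using g continuous_bump[of UNIV y] by (intro continuous_intros) auto
    then have gi: "((\<lambda>x. g x * bump y x ^ n) has_integral 0) (cbox 0 1)"
      using z[of n] continuous_integrable_box[OF cont, of 0 1] torus_integral_HK[OF cont]
      by (simp add: has_integral_integrable_integral)
    have "c * r ^ n * V - M * q ^ n \<le> 0"
    proof (rule has_integral_le[OF has_integral_diff[OF ind cst] gi])
      fix x :: "real^'n" assume x: "x \<in> cbox 0 1"
      have q': "0 \<le> M * q ^ n" using M q by simp
      have P: "0 \<le> bump y x ^ n" by (intro zero_le_power bump_bounds(1))
      \<comment> \<open>On the small ball the integrand has its lower bound c r^n, between the two
        balls only its nonnegativity is used, and on \<open>K\<close> it may be negative but is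
        small.\<close>
      consider "x \<in> ball y \<epsilon>" | "x \<notin> ball y \<epsilon>" "x \<in> ball y \<delta>" | "x \<notin> ball y \<epsilon>" "x \<in> K"
        using x by (auto simp: K_def)
      then show "(if x \<in> ball y \<epsilon> then c * r ^ n else 0) - M * q ^ n \<le> g x * bump y x ^ n"
      proof cases
        case 1
        then have "r \<le> bump y x" "c \<le> g x" using \<epsilon>(2) \<delta>(2) by (auto simp: subset_iff less_imp_le)
        moreover have "0 \<le> r" using q r by simp
        ultimately have "c * r ^ n \<le> g x * bump y x ^ n"
          using c by (intro mult_mono power_mono) auto
        then show ?thesis using 1 q' by simp
      next
        case 2
        then have "0 \<le> g x" using \<delta>(2) c by (auto simp: subset_iff less_imp_le intro: order_trans)
        then show ?thesis using 2 q' P by (simp add: order_trans[OF _ mult_nonneg_nonneg])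
      next
        case 3
        have "- (M * q ^ n) \<le> - M * bump y x ^ n"
          using q(3)[OF 3(2)] M(2) bump_bounds(1)[of y x] by (simp add: mult_left_mono power_mono)
        also have "\<dots> \<le> g x * bump y x ^ n" using M(1)[OF x] P by (intro mult_right_mono)
        finally show ?thesis using 3 by simp
      qed
    qed
    then show ?thesis by (simp add: mult_ac)
  qed
  have r0: "0 < r" using q r by linarith
  have "c * V \<le> M * (q / r) ^ n" for n
    using main[of n] r0 by (simp add: power_divide field_simps)
  moreover have "(\<lambda>n. M * (q / r) ^ n) \<longlonglongrightarrow> M * 0"
    using q r r0 by (intro tendsto_intros LIMSEQ_realpow_zero) (auto simp: divide_simps)
  ultimately have "c * V \<le> 0"
    using LIMSEQ_le_const by fastforce
  with c V show False by (simp add: mult_le_0_iff)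
qed

text \<open>At an interior point \<open>y\<close> with f y \<noteq> 0, the real part of cnj (f y) *
  f is positive while all its moments against powers of the bump vanish. The boundary of the cell
  follows by continuity, the rest by periodicity.\<close>

lemma fourier_uniqueness:
  fixes f :: "real^'n::finite \<Rightarrow> complex"
  assumes f: "continuous_on UNIV f" and per: "periodic f" and z: "\<And>k. fourier_coeff f k = 0"
  shows "f x = 0"
proof -
  have int: "f y = 0" if y: "y \<in> box 0 1" for y
  proof (rule ccontr)
    assume ne: "f y \<noteq> 0"
    define g where "g x = Re (cnj (f y) * f x)" for x
    have g: "continuous_on UNIV g" unfolding g_def using f by (intro continuous_intros)
    have "0 < g y" using ne by (simp add: g_def cmod_power2[symmetric] power2_eq_square[symmetric])
    moreover have "torus_integral (\<lambda>x. g x * bump y x ^ n) = 0" for n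
    proof -
      have cont: "continuous_on UNIV (\<lambda>x. f x * of_real (bump y x ^ n))"
        using f continuous_bump[of UNIV y] by (intro continuous_intros) auto
      have "(\<lambda>x. g x * bump y x ^ n) = (\<lambda>x. Re (cnj (f y) * (f x * of_real (bump y x ^ n))))"
        by (simp add: g_def algebra_simps flip: of_real_power)
      then have "torus_integral (\<lambda>x. g x * bump y x ^ n) =
          Re (torus_integral (\<lambda>x. cnj (f y) * (f x * of_real (bump y x ^ n))))"
        using cont by (simp only: torus_integral_Re continuous_on_mult continuous_on_const)
      also have "\<dots> = Re (cnj (f y) * 0)"
        by (simp only: torus_integral_cmult[OF cont] integral_bump_power_zero[OF f z])
      finally show ?thesis by simp
    qed
    ultimately show False using bump_moments_nonzero[OF g y] by blast
  qed
  have box_ne: "box 0 (1::real^'n) \<noteq> {}" by (simp add: interval_ne_empty_cart)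
  have cl: "f y = 0" if y: "y \<in> cbox 0 1" for y
  proof (rule continuous_constant_on_closure[of "box 0 1" f])
    show "continuous_on (closure (box 0 1)) f" using f continuous_on_subset by blast
    show "y \<in> closure (box 0 1)" using y box_ne by (simp add: closure_box)
  qed (rule int)
  \<comment> \<open>Subtracting the integer parts of the coordinates moves \<open>x\<close> into the
    unit cell.\<close>
  define k where "k = (\<chi> i. - \<lfloor>x $ i\<rfloor>)"
  have "x + lattice_vec k \<in> cbox 0 1"
    by (auto simp: mem_box_cart k_def) linarith
  then have "f (x + lattice_vec k) = 0" by (rule cl)
  then show ?thesis using per by (simp add: periodic_def)
qed

section \<open>The spectral space\<close>

definition laplace_eigenvalue :: "int^'n::finite \<Rightarrow> real" where
  "laplace_eigenvalue k = 4 * pi\<^sup>2 * (norm (lattice_vec k :: real^'n))\<^sup>2"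

definition shell :: "real \<Rightarrow> real \<Rightarrow> (int^'n::finite) set" where
  "shell \<alpha> h = {k. h\<^sup>2 * laplace_eigenvalue k \<in> spectral_window \<alpha> h}"

lemma fourier_coeff_laplacian:
  fixes f :: "real^'n::finite \<Rightarrow> complex"
  assumes "torus_smooth f"
  shows "fourier_coeff (laplacian f) k = - of_real (laplace_eigenvalue k) * fourier_coeff f k"
proof -
  have sm: "torus_smooth (partial i (partial i f))" for i
    using assms by (intro torus_smooth_partial)
  have "fourier_coeff (laplacian f) k = (\<Sum>i\<in>UNIV. fourier_coeff (partial i (partial i f)) k)"
    unfolding laplacian_def[abs_def] by (intro fourier_coeff_sum torus_smooth_continuous sm) simp
  also have "\<dots> = (\<Sum>i\<in>UNIV. - of_real (4 * pi\<^sup>2 * (of_int (k $ i))\<^sup>2) * fourier_coeff f k)"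
    using assms torus_smooth_partial[OF assms]
    by (intro sum.cong refl) (simp add: fourier_coeff_partial power2_eq_square mult_ac)
  also have "\<dots> = - of_real (\<Sum>i\<in>UNIV. 4 * pi\<^sup>2 * (of_int (k $ i))\<^sup>2) * fourier_coeff f k"
    by (simp only: sum_distrib_right[symmetric] sum_negf of_real_sum)
  also have "(\<Sum>i\<in>UNIV. 4 * pi\<^sup>2 * (real_of_int (k $ i))\<^sup>2) = laplace_eigenvalue k"
    by (simp add: laplace_eigenvalue_def norm_sq_vec sum_distrib_left)
  finally show ?thesis .
qed

lemma laplacian_character:
  fixes k :: "int^'n::finite"
  shows "laplacian (character k) x = - of_real (laplace_eigenvalue k) * character k x"
proof -
  have "partial i (partial i (character k)) x = - of_real (4 * pi\<^sup>2 * (of_int (k $ i))\<^sup>2) * character k x" for i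
    unfolding partial_character partial_cmult[OF differentiable_character]
    by (simp add: power2_eq_square mult_ac)
  then have "laplacian (character k) x = (\<Sum>i\<in>UNIV. - of_real (4 * pi\<^sup>2 * (of_int (k $ i))\<^sup>2) * character k x)"
    unfolding laplacian_def by simp
  also have "\<dots> = - of_real (\<Sum>i\<in>UNIV. 4 * pi\<^sup>2 * (of_int (k $ i))\<^sup>2) * character k x"
    by (simp only: sum_distrib_right[symmetric] sum_negf of_real_sum)
  also have "(\<Sum>i\<in>UNIV. 4 * pi\<^sup>2 * (real_of_int (k $ i))\<^sup>2) = laplace_eigenvalue k"
    by (simp add: laplace_eigenvalue_def norm_sq_vec sum_distrib_left)
  finally show ?thesis .
qed

lemma eigenfunction_character: "eigenfunction h (h\<^sup>2 * laplace_eigenvalue k) (character k)"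
  by (simp add: eigenfunction_def torus_smooth_character laplacian_character)

text \<open>On the Fourier side the eigenvalue equation says that the coefficient at
  \<open>k\<close> is annihilated by h^2 \<open>laplace_eigenvalue k\<close> - E.\<close>

lemma eigenfunction_fourier_support:
  assumes eig: "eigenfunction h E \<psi>" and ne: "fourier_coeff \<psi> k \<noteq> 0"
  shows "h\<^sup>2 * laplace_eigenvalue k = E"
proof -
  have sm: "torus_smooth \<psi>" and eq: "- of_real (h\<^sup>2) * laplacian \<psi> x = of_real E * \<psi> x" for x
    using eig by (auto simp: eigenfunction_def)
  have cont: "continuous_on UNIV (laplacian \<psi>)"
    unfolding laplacian_def[abs_def]
    by (intro continuous_on_sum torus_smooth_continuous torus_smooth_partial sm)
  have "of_real E * fourier_coeff \<psi> k = fourier_coeff (\<lambda>x. - of_real (h\<^sup>2) * laplacian \<psi> x) k"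
    unfolding eq by (rule fourier_coeff_cmult[OF torus_smooth_continuous[OF sm], symmetric])
  also have "\<dots> = - of_real (h\<^sup>2) * fourier_coeff (laplacian \<psi>) k"
    by (rule fourier_coeff_cmult[OF cont])
  also have "\<dots> = of_real (h\<^sup>2 * laplace_eigenvalue k) * fourier_coeff \<psi> k"
    by (simp add: fourier_coeff_laplacian[OF sm])
  finally show ?thesis using ne by (simp only: mult_cancel_right of_real_eq_iff) simp
qed

text \<open>This puts the window into the form A \<le> |k|^2 \<le> A + L of the counting lemmas,
  with A of order h^-2 and L of order h^-1 for small h.\<close>

lemma shell_iff:
  fixes k :: "int^'n::finite"
  assumes "0 < h"
  shows "k \<in> shell \<alpha> h \<longleftrightarrow>
    (1 - \<alpha> * h) / (4 * pi\<^sup>2 * h\<^sup>2) \<le> (norm (lattice_vec k :: real^'n))\<^sup>2 \<and>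
    (norm (lattice_vec k :: real^'n))\<^sup>2 \<le> (1 - \<alpha> * h) / (4 * pi\<^sup>2 * h\<^sup>2) + \<alpha> / (2 * pi\<^sup>2 * h)"
proof -
  have e: "(1 - \<alpha> * h) / (4 * pi\<^sup>2 * h\<^sup>2) + \<alpha> / (2 * pi\<^sup>2 * h) = (1 + \<alpha> * h) / (4 * pi\<^sup>2 * h\<^sup>2)"
    using assms by (simp add: field_simps power2_eq_square)
  have "0 < 4 * pi\<^sup>2 * h\<^sup>2" using assms by simp
  then show ?thesis
    unfolding e by (simp add: shell_def spectral_window_def laplace_eigenvalue_def
        pos_divide_le_eq pos_le_divide_eq mult_ac)
qed

lemma finite_shell: "0 < h \<Longrightarrow> finite (shell \<alpha> h)"
  by (rule finite_subset[OF _ finite_lattice_ball[of "(1 - \<alpha> * h) / (4 * pi\<^sup>2 * h\<^sup>2) + \<alpha> / (2 * pi\<^sup>2 * h)"]])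
    (auto simp: shell_iff)

text \<open>All nonzero coefficients lie in the finite set \<open>shell \<alpha> h\<close>, so the
  difference of the two sides is continuous and periodic with vanishing Fourier
  coefficients.\<close>

lemma eigenfunction_expansion:
  fixes \<psi> :: "real^'n::finite \<Rightarrow> complex"
  assumes h: "0 < h" and E: "E \<in> spectral_window \<alpha> h" and eig: "eigenfunction h E \<psi>"
  shows "\<psi> x = (\<Sum>k\<in>shell \<alpha> h. fourier_coeff \<psi> k * character k x)"
proof -
  let ?S = "\<lambda>x. \<Sum>k\<in>shell \<alpha> h. fourier_coeff \<psi> k * character k x"
  have sm: "torus_smooth \<psi>" using eig by (simp add: eigenfunction_def)
  have fin: "finite (shell \<alpha> h :: (int^'n) set)" using h by (rule finite_shell)
  have contS: "continuous_on UNIV ?S" by (intro continuous_intros)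
  have "(\<lambda>x. \<psi> x - ?S x) x = 0"
  proof (rule fourier_uniqueness)
    show "continuous_on UNIV (\<lambda>x. \<psi> x - ?S x)"
      using contS torus_smooth_continuous[OF sm] by (intro continuous_on_diff)
    show "periodic (\<lambda>x. \<psi> x - ?S x)"
      using sm by (simp add: periodic_def torus_smooth_def periodic_character[unfolded periodic_def, rule_format])
    fix l
    have "fourier_coeff ?S l = (\<Sum>k\<in>shell \<alpha> h. fourier_coeff \<psi> k * fourier_coeff (character k) l)"
      using fin by (simp add: fourier_coeff_sum fourier_coeff_cmult continuous_character continuous_intros)
    also have "\<dots> = (\<Sum>k\<in>shell \<alpha> h. if k = l then fourier_coeff \<psi> k else 0)"
      by (intro sum.cong) (auto simp: fourier_coeff_of_character)
    also have "\<dots> = (if l \<in> shell \<alpha> h then fourier_coeff \<psi> l else 0)"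
      using fin by (rule sum.delta)
    also have "\<dots> = fourier_coeff \<psi> l"
      using eigenfunction_fourier_support[OF eig, of l] E by (auto simp: shell_def)
    finally show "fourier_coeff (\<lambda>x. \<psi> x - ?S x) l = 0"
      by (simp add: fourier_coeff_diff[OF torus_smooth_continuous[OF sm] contS])
  qed
  then show ?thesis by simp
qed

section \<open>The characters of the window as a basis of the spectral space\<close>

lemma sum_fun_apply: "(sum f S) x = (\<Sum>i\<in>S. f i x)"
  by (induction S rule: infinite_finite_induct) auto

lemma inj_character: "inj character"
proof (rule injI)
  fix k l :: "int^'n" assume "character k = character l"
  then have "fourier_coeff (character k) k = fourier_coeff (character l) k" by simp
  then show "k = l" by (simp add: fourier_coeff_of_character split: if_splits)
qed

lemma independent_characters:
  assumes "finite S"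
  shows "cfun.independent (character ` S)"
proof
  assume "cfun.dependent (character ` S)"
  then obtain u where u: "\<exists>v\<in>character ` S. u v \<noteq> 0" "(\<Sum>v\<in>character ` S. (\<lambda>x. u v * v x)) = 0"
    using assms by (auto simp: cfun.dependent_finite)
  have "(\<Sum>k\<in>S. u (character k) * character k x) = 0" for x
    using fun_cong[OF u(2), of x]
    by (simp add: sum_fun_apply sum.reindex inj_on_subset[OF inj_character])
  then have z: "(\<lambda>x. \<Sum>k\<in>S. u (character k) * character k x) = (\<lambda>x. 0 * character 0 x)" by simp
  have "u (character l) = 0" if "l \<in> S" for l
  proof -
    have "fourier_coeff (\<lambda>x. \<Sum>k\<in>S. u (character k) * character k x) l =
        (\<Sum>k\<in>S. u (character k) * fourier_coeff (character k) l)"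
      using assms by (simp add: fourier_coeff_sum fourier_coeff_cmult continuous_character continuous_intros)
    also have "\<dots> = (\<Sum>k\<in>S. if k = l then u (character k) else 0)"
      by (intro sum.cong) (auto simp: fourier_coeff_of_character)
    also have "\<dots> = u (character l)" using assms that by (simp add: sum.delta)
    finally show ?thesis unfolding z fourier_coeff_cmult[OF continuous_character] by simp
  qed
  with u(1) show False by blast
qed

lemma spectral_space_eq:
  assumes h: "0 < h"
  shows "spectral_space \<alpha> h = cfun.span (character ` (shell \<alpha> h))"
proof -
  have "\<psi> \<in> cfun.span (character ` (shell \<alpha> h))"
    if "E \<in> spectral_window \<alpha> h" "eigenfunction h E \<psi>" for E \<psi>
  proof -
    have "\<psi> = (\<Sum>k\<in>shell \<alpha> h. (\<lambda>x. fourier_coeff \<psi> k * character k x))"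
      using eigenfunction_expansion[OF h that] by (auto simp: sum_fun_apply)
    moreover have "(\<Sum>k\<in>shell \<alpha> h. (\<lambda>x. fourier_coeff \<psi> k * character k x)) \<in> cfun.span (character ` (shell \<alpha> h))"
      by (intro cfun.span_sum cfun.span_scale cfun.span_base) auto
    ultimately show ?thesis by simp
  qed
  moreover have "character k \<in> cfun.span {\<psi>. \<exists>E\<in>spectral_window \<alpha> h. eigenfunction h E \<psi>}"
    if "k \<in> shell \<alpha> h" for k
    using that eigenfunction_character by (intro cfun.span_base) (auto simp: shell_def)
  ultimately show ?thesis
    unfolding spectral_space_def by (intro cfun.span_eq[THEN iffD2]) blast
qed

lemma spectral_dim_eq:
  assumes "0 < h"
  shows "spectral_dim TYPE('n::finite) \<alpha> h = card (shell \<alpha> h :: (int^'n) set)"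
proof -
  have "spectral_dim TYPE('n) \<alpha> h = cfun.dim (cfun.span (character ` (shell \<alpha> h :: (int^'n) set)))"
    by (simp only: spectral_dim_def spectral_space_eq[OF assms])
  also have "\<dots> = card (character ` (shell \<alpha> h :: (int^'n) set))"
    by (intro cfun.dim_span_eq_card_independent independent_characters finite_shell assms)
  also have "\<dots> = card (shell \<alpha> h :: (int^'n) set)"
    by (intro card_image inj_on_subset[OF inj_character]) simp
  finally show ?thesis .
qed

section \<open>The Hilbert--Schmidt bound\<close>

text \<open>Bessel's inequality for the conjugate vectors \<open>cnj (c j k)\<close>, which are
  orthonormal along with the \<open>c j k\<close>; \<open>s\<close> is the projection of
  \<open>v\<close> onto their span.\<close>

lemma bessel_orthonormal_vectors:
  fixes c :: "'j \<Rightarrow> 'k \<Rightarrow> complex"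
  assumes J: "finite J"
    and on: "\<And>i j. i \<in> J \<Longrightarrow> j \<in> J \<Longrightarrow> (\<Sum>k\<in>K. c i k * cnj (c j k)) = (if i = j then 1 else 0)"
  shows "(\<Sum>j\<in>J. (cmod (\<Sum>k\<in>K. v k * c j k))\<^sup>2) \<le> (\<Sum>k\<in>K. (cmod (v k))\<^sup>2)"
proof -
  define \<beta> where "\<beta> j = (\<Sum>k\<in>K. v k * c j k)" for j
  define s where "s k = (\<Sum>j\<in>J. \<beta> j * cnj (c j k))" for k
  let ?B = "\<Sum>j\<in>J. (cmod (\<beta> j))\<^sup>2"
  have "(\<Sum>k\<in>K. v k * cnj (s k)) = (\<Sum>k\<in>K. \<Sum>j\<in>J. cnj (\<beta> j) * (v k * c j k))"
    by (simp add: s_def sum_distrib_left mult_ac)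
  also have "\<dots> = (\<Sum>j\<in>J. \<Sum>k\<in>K. cnj (\<beta> j) * (v k * c j k))"
    by (rule sum.swap)
  also have "\<dots> = (\<Sum>j\<in>J. cnj (\<beta> j) * \<beta> j)"
    by (simp add: \<beta>_def sum_distrib_left)
  also have "\<dots> = of_real ?B" by (simp add: mult.commute flip: complex_norm_square)
  finally have 1: "(\<Sum>k\<in>K. v k * cnj (s k)) = of_real ?B" .
  have "(\<Sum>k\<in>K. s k * cnj (s k)) = (\<Sum>k\<in>K. \<Sum>i\<in>J. \<Sum>j\<in>J. (\<beta> i * cnj (c i k)) * (cnj (\<beta> j) * c j k))"
    by (simp add: s_def sum_product)
  also have "\<dots> = (\<Sum>i\<in>J. \<Sum>j\<in>J. \<Sum>k\<in>K. (\<beta> i * cnj (c i k)) * (cnj (\<beta> j) * c j k))"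
    by (subst sum.swap, rule sum.cong[OF refl], rule sum.swap)
  also have "\<dots> = (\<Sum>i\<in>J. \<Sum>j\<in>J. \<beta> i * cnj (\<beta> j) * (\<Sum>k\<in>K. c j k * cnj (c i k)))"
    by (simp add: sum_distrib_left mult_ac)
  also have "\<dots> = (\<Sum>i\<in>J. \<Sum>j\<in>J. if i = j then \<beta> i * cnj (\<beta> j) else 0)"
    by (intro sum.cong refl) (auto simp: on)
  also have "\<dots> = of_real ?B" using J by (simp add: sum.delta flip: complex_norm_square)
  finally have 2: "(\<Sum>k\<in>K. s k * cnj (s k)) = of_real ?B" .
  have "?B = Re (2 * (\<Sum>k\<in>K. v k * cnj (s k)) - (\<Sum>k\<in>K. s k * cnj (s k)))"
    unfolding 1 2 by simp
  also have "\<dots> = (\<Sum>k\<in>K. Re (2 * (v k * cnj (s k)) - s k * cnj (s k)))"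
    by (simp only: Re_sum sum_subtractf sum_distrib_left minus_complex.simps)
  also have "\<dots> \<le> (\<Sum>k\<in>K. (cmod (v k))\<^sup>2)"
  proof (rule sum_mono)
    fix k
    have "0 \<le> (cmod (v k - s k))\<^sup>2" by simp
    then show "Re (2 * (v k * cnj (s k)) - s k * cnj (s k)) \<le> (cmod (v k))\<^sup>2"
      by (simp only: cmod_power2 minus_complex.simps times_complex.simps complex_cnj)
        (simp add: power2_eq_square algebra_simps)
  qed
  finally show ?thesis by (simp add: \<beta>_def)
qed

text \<open>Since c_j is a unit vector, Cauchy--Schwarz bounds its diagonal element by the norm of A
  c_j. Bessel's inequality, applied to each row of \<open>A\<close>, then sums the squares over
  \<open>j\<close>.\<close>

lemma sum_diagonal_elements_le_HS:
  fixes c :: "'j \<Rightarrow> 'k \<Rightarrow> complex" and A :: "'k \<Rightarrow> 'k \<Rightarrow> complex"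
  assumes J: "finite J"
    and on: "\<And>i j. i \<in> J \<Longrightarrow> j \<in> J \<Longrightarrow> (\<Sum>k\<in>K. c i k * cnj (c j k)) = (if i = j then 1 else 0)"
  shows "(\<Sum>j\<in>J. (cmod (\<Sum>k\<in>K. \<Sum>l\<in>K. c j k * cnj (c j l) * A l k))\<^sup>2) \<le> (\<Sum>l\<in>K. \<Sum>k\<in>K. (cmod (A l k))\<^sup>2)"
proof -
  have "(\<Sum>j\<in>J. (cmod (\<Sum>k\<in>K. \<Sum>l\<in>K. c j k * cnj (c j l) * A l k))\<^sup>2) \<le>
      (\<Sum>j\<in>J. \<Sum>l\<in>K. (cmod (\<Sum>k\<in>K. A l k * c j k))\<^sup>2)"
  proof (rule sum_mono)
    fix j assume j: "j \<in> J"
    have "(\<Sum>l\<in>K. complex_of_real ((cmod (c j l))\<^sup>2)) = 1"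
      using on[OF j j] by (simp only: complex_norm_square) simp
    then have norm1: "(\<Sum>l\<in>K. (cmod (c j l))\<^sup>2) = 1"
      by (simp only: of_real_sum[symmetric] of_real_eq_1_iff)
    have "(\<Sum>k\<in>K. \<Sum>l\<in>K. c j k * cnj (c j l) * A l k) = (\<Sum>l\<in>K. cnj (c j l) * (\<Sum>k\<in>K. A l k * c j k))"
      by (subst sum.swap) (simp add: sum_distrib_left mult_ac)
    then have "cmod (\<Sum>k\<in>K. \<Sum>l\<in>K. c j k * cnj (c j l) * A l k) \<le>
        (\<Sum>l\<in>K. cmod (c j l) * cmod (\<Sum>k\<in>K. A l k * c j k))"
      using norm_sum[of "\<lambda>l. cnj (c j l) * (\<Sum>k\<in>K. A l k * c j k)" K] by (simp add: norm_mult)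
    then have "(cmod (\<Sum>k\<in>K. \<Sum>l\<in>K. c j k * cnj (c j l) * A l k))\<^sup>2 \<le>
        (\<Sum>l\<in>K. cmod (c j l) * cmod (\<Sum>k\<in>K. A l k * c j k))\<^sup>2"
      by (intro power_mono) auto
    also have "\<dots> \<le> (\<Sum>l\<in>K. (cmod (c j l))\<^sup>2) * (\<Sum>l\<in>K. (cmod (\<Sum>k\<in>K. A l k * c j k))\<^sup>2)"
      by (rule Cauchy_Schwarz_ineq_sum)
    finally show "(cmod (\<Sum>k\<in>K. \<Sum>l\<in>K. c j k * cnj (c j l) * A l k))\<^sup>2 \<le>
        (\<Sum>l\<in>K. (cmod (\<Sum>k\<in>K. A l k * c j k))\<^sup>2)"
      by (simp add: norm1)
  qed
  also have "\<dots> = (\<Sum>l\<in>K. \<Sum>j\<in>J. (cmod (\<Sum>k\<in>K. A l k * c j k))\<^sup>2)"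
    by (rule sum.swap)
  also have "\<dots> \<le> (\<Sum>l\<in>K. \<Sum>k\<in>K. (cmod (A l k))\<^sup>2)"
    by (intro sum_mono bessel_orthonormal_vectors J on)
  finally show ?thesis .
qed

lemma eigen_variance_bound:
  fixes a :: "real^'n::finite \<Rightarrow> complex" and \<psi> :: "nat \<Rightarrow> real^'n \<Rightarrow> complex"
  assumes h: "0 < h" and onb: "eigen_onb \<alpha> h \<psi>" and a: "continuous_on UNIV a"
  obtains D where "finite D" "0 \<notin> D"
    "(\<Sum>j = 1..card (shell \<alpha> h :: (int^'n) set).
        (cmod (torus_integral (\<lambda>x. a x * of_real ((cmod (\<psi> j x))\<^sup>2)) - torus_integral a))\<^sup>2) \<le>
     (\<Sum>m\<in>D. (cmod (fourier_coeff a m))\<^sup>2 *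
        real (card {k \<in> shell \<alpha> h. norm (lattice_vec (k + m) :: real^'n) = norm (lattice_vec k :: real^'n)}))"
proof -
  let ?\<Lambda> = "shell \<alpha> h :: (int^'n) set"
  let ?J = "{1..card ?\<Lambda>}"
  let ?n = "\<lambda>k::int^'n. norm (lattice_vec k :: real^'n)"
  have fin: "finite ?\<Lambda>" using h by (rule finite_shell)
  note dim = spectral_dim_eq[OF h, of \<alpha>, where 'n = 'n]
  define c where "c j k = fourier_coeff (\<psi> j) k" for j k
  \<comment> \<open>One matrix serves all \<open>j\<close>: entries between different spheres may be
    set to 0, because the coefficients of each single \<psi>_j live on one sphere. The entries with
    k = l are left out since they add up to the mean of \<open>a\<close>, which is
    subtracted.\<close>
  define A where "A l k = (if k \<noteq> l \<and> ?n k = ?n l then fourier_coeff a (l - k) else 0)" for l k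
  have E: "\<exists>E\<in>spectral_window \<alpha> h. eigenfunction h E (\<psi> j)" if "j \<in> ?J" for j
    using onb that unfolding eigen_onb_def dim by blast
  have exp: "\<psi> j = (\<lambda>x. \<Sum>k\<in>?\<Lambda>. c j k * character k x)" if "j \<in> ?J" for j
    using E[OF that] eigenfunction_expansion[OF h] unfolding c_def by blast
  have on: "(\<Sum>k\<in>?\<Lambda>. c i k * cnj (c j k)) = (if i = j then 1 else 0)" if "i \<in> ?J" "j \<in> ?J" for i j
  proof -
    have "L2_inner (\<psi> i) (\<psi> j) = (if i = j then 1 else 0)"
      using onb that unfolding eigen_onb_def dim by blast
    moreover have "L2_inner (\<psi> i) (\<psi> j) = (\<Sum>k\<in>?\<Lambda>. c i k * cnj (c j k))"
      by (subst exp[OF that(1)], subst exp[OF that(2)], rule L2_inner_trig[OF fin])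
    ultimately show ?thesis by simp
  qed
  have same: "?n k = ?n l" if j: "j \<in> ?J" and ne: "c j k \<noteq> 0" "c j l \<noteq> 0" for j k l
  proof -
    obtain E where "eigenfunction h E (\<psi> j)" using E[OF j] by blast
    then have "h\<^sup>2 * laplace_eigenvalue k = h\<^sup>2 * laplace_eigenvalue l"
      using ne eigenfunction_fourier_support unfolding c_def by metis
    then show ?thesis using h by (simp add: laplace_eigenvalue_def)
  qed
  have form: "torus_integral (\<lambda>x. a x * of_real ((cmod (\<psi> j x))\<^sup>2)) - torus_integral a =
      (\<Sum>k\<in>?\<Lambda>. \<Sum>l\<in>?\<Lambda>. c j k * cnj (c j l) * A l k)" if j: "j \<in> ?J" for j
  proof -
    have "torus_integral (\<lambda>x. a x * of_real ((cmod (\<psi> j x))\<^sup>2)) =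
        torus_integral (\<lambda>x. a x * \<psi> j x * cnj (\<psi> j x))"
      by (simp only: complex_norm_square mult.assoc)
    also have "\<dots> = (\<Sum>k\<in>?\<Lambda>. \<Sum>l\<in>?\<Lambda>. c j k * cnj (c j l) * fourier_coeff a (l - k))"
      unfolding exp[OF j] by (rule torus_integral_trig_form[OF a fin fin])
    also have "\<dots> = (\<Sum>k\<in>?\<Lambda>. \<Sum>l\<in>?\<Lambda>. c j k * cnj (c j l) * A l k +
        (if l = k then c j k * cnj (c j l) * fourier_coeff a 0 else 0))"
      by (intro sum.cong refl) (use same[OF j] in \<open>auto simp: A_def\<close>)
    also have "\<dots> = (\<Sum>k\<in>?\<Lambda>. \<Sum>l\<in>?\<Lambda>. c j k * cnj (c j l) * A l k) +
        (\<Sum>k\<in>?\<Lambda>. c j k * cnj (c j k)) * fourier_coeff a 0"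
      using fin by (simp add: sum.distrib sum.delta sum_distrib_right)
    also have "(\<Sum>k\<in>?\<Lambda>. c j k * cnj (c j k)) = 1" using on[OF j j] by simp
    finally show ?thesis by (simp add: fourier_coeff_character)
  qed
  define S where "S = {(l, k) \<in> ?\<Lambda> \<times> ?\<Lambda>. k \<noteq> l \<and> ?n k = ?n l}"
  define D where "D = (\<lambda>(l, k). l - k) ` S"
  have finS: "finite S" unfolding S_def by (rule finite_subset[OF _ finite_cartesian_product[OF fin fin]]) auto
  have "(\<Sum>j\<in>?J. (cmod (torus_integral (\<lambda>x. a x * of_real ((cmod (\<psi> j x))\<^sup>2)) - torus_integral a))\<^sup>2) =
      (\<Sum>j\<in>?J. (cmod (\<Sum>k\<in>?\<Lambda>. \<Sum>l\<in>?\<Lambda>. c j k * cnj (c j l) * A l k))\<^sup>2)"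
    by (intro sum.cong refl) (simp only: form)
  also have "\<dots> \<le> (\<Sum>l\<in>?\<Lambda>. \<Sum>k\<in>?\<Lambda>. (cmod (A l k))\<^sup>2)"
    by (intro sum_diagonal_elements_le_HS on) simp_all
  also have "\<dots> = (\<Sum>(l, k)\<in>?\<Lambda> \<times> ?\<Lambda>. (cmod (A l k))\<^sup>2)"
    by (rule sum.cartesian_product)
  also have "\<dots> = (\<Sum>(l, k)\<in>S. (cmod (fourier_coeff a (l - k)))\<^sup>2)"
    by (rule sum.mono_neutral_cong_right) (auto simp: S_def A_def fin split: if_splits)
  \<comment> \<open>Pairs are regrouped by their difference m = l - k, on which the coefficient of
    \<open>a\<close> depends.\<close>
  also have "\<dots> = (\<Sum>m\<in>D. \<Sum>z\<in>{z \<in> S. (\<lambda>(l, k). l - k) z = m}. (\<lambda>(l, k). (cmod (fourier_coeff a (l - k)))\<^sup>2) z)"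
    unfolding D_def by (rule sum.image_gen[OF finS])
  also have "\<dots> \<le> (\<Sum>m\<in>D. (cmod (fourier_coeff a m))\<^sup>2 * real (card {k \<in> ?\<Lambda>. ?n (k + m) = ?n k}))"
  proof (rule sum_mono)
    fix m assume "m \<in> D"
    let ?Z = "{z \<in> S. (\<lambda>(l, k). l - k) z = m}"
    have "(\<Sum>z\<in>?Z. (\<lambda>(l, k). (cmod (fourier_coeff a (l - k)))\<^sup>2) z) = (\<Sum>z\<in>?Z. (cmod (fourier_coeff a m))\<^sup>2)"
      by (intro sum.cong refl) auto
    also have "\<dots> = (cmod (fourier_coeff a m))\<^sup>2 * real (card ?Z)" by simp
    also have "\<dots> \<le> (cmod (fourier_coeff a m))\<^sup>2 * real (card {k \<in> ?\<Lambda>. ?n (k + m) = ?n k})"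
    proof (intro mult_left_mono of_nat_mono)
      \<comment> \<open>For fixed \<open>m\<close>, the pair is determined by \<open>k\<close>, as l
        = k + m.\<close>
      have "inj_on snd ?Z" by (auto simp: inj_on_def)
      moreover have "snd ` ?Z \<subseteq> {k \<in> ?\<Lambda>. ?n (k + m) = ?n k}" by (auto simp: S_def)
      ultimately show "card ?Z \<le> card {k \<in> ?\<Lambda>. ?n (k + m) = ?n k}"
        using fin by (intro card_inj_on_le) auto
    qed simp
    finally show "(\<Sum>z\<in>?Z. (\<lambda>(l, k). (cmod (fourier_coeff a (l - k)))\<^sup>2) z) \<le>
        (cmod (fourier_coeff a m))\<^sup>2 * real (card {k \<in> ?\<Lambda>. ?n (k + m) = ?n k})" .
  qed
  finally have "(\<Sum>j\<in>?J. (cmod (torus_integral (\<lambda>x. a x * of_real ((cmod (\<psi> j x))\<^sup>2)) - torus_integral a))\<^sup>2) \<le>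
      (\<Sum>m\<in>D. (cmod (fourier_coeff a m))\<^sup>2 * real (card {k \<in> ?\<Lambda>. ?n (k + m) = ?n k}))" .
  moreover have "finite D" "0 \<notin> D" using finS by (auto simp: D_def S_def)
  ultimately show ?thesis using that by blast
qed

section \<open>Sobolev norms and semiclassical lattice counts\<close>

text \<open>With M the largest of 1 and the squares, the left side is at most ((d + 1) M)^p, and M^p
  is 1 or a single (x_i^p)^2. The benefit is that Sobolev weights are controlled by pure
  derivatives, without mixed ones.\<close>

lemma sum_power_bound:
  fixes x :: "'n::finite \<Rightarrow> real"
  shows "(1 + (\<Sum>i\<in>UNIV. (x i)\<^sup>2)) ^ p \<le> (real CARD('n) + 1) ^ p * (1 + (\<Sum>i\<in>UNIV. (x i ^ p)\<^sup>2))"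
proof -
  define M where "M = Max (insert 1 (range (\<lambda>i. (x i)\<^sup>2)))"
  have M: "1 \<le> M" "(x i)\<^sup>2 \<le> M" for i unfolding M_def by (rule Max_ge; simp)+
  have "(\<Sum>i\<in>UNIV. (x i)\<^sup>2) \<le> (\<Sum>i\<in>(UNIV :: 'n set). M)" by (intro sum_mono M)
  then have "1 + (\<Sum>i\<in>UNIV. (x i)\<^sup>2) \<le> (real CARD('n) + 1) * M" using M(1) by (simp add: algebra_simps)
  then have "(1 + (\<Sum>i\<in>UNIV. (x i)\<^sup>2)) ^ p \<le> ((real CARD('n) + 1) * M) ^ p"
    by (intro power_mono) (auto simp: sum_nonneg add_nonneg_nonneg)
  also have "\<dots> = (real CARD('n) + 1) ^ p * M ^ p" by (rule power_mult_distrib)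
  also have "M ^ p \<le> 1 + (\<Sum>i\<in>UNIV. (x i ^ p)\<^sup>2)"
  proof -
    have "M \<in> insert 1 (range (\<lambda>i. (x i)\<^sup>2))" unfolding M_def by (intro Max_in) auto
    then consider "M = 1" | i where "M = (x i)\<^sup>2" by auto
    then show ?thesis
    proof cases
      case 1
      then show ?thesis by (simp add: sum_nonneg)
    next
      case 2
      have "M ^ p = (x i ^ p)\<^sup>2" using 2 by (simp add: power_mult[symmetric] mult.commute)
      also have "\<dots> \<le> (\<Sum>i\<in>UNIV. (x i ^ p)\<^sup>2)" by (rule member_le_sum) auto
      finally show ?thesis by simp
    qed
  qed
  finally show ?thesis by (simp add: mult_left_mono)
qed

lemma torus_smooth_partial_power: "torus_smooth f \<Longrightarrow> torus_smooth ((partial i ^^ p) f)"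
  by (induction p) (auto intro: torus_smooth_partial)

lemma fourier_coeff_partial_power:
  "torus_smooth f \<Longrightarrow> fourier_coeff ((partial i ^^ p) f) k = (2 * pi * \<i> * of_int (k $ i)) ^ p * fourier_coeff f k"
  by (induction p) (simp_all add: fourier_coeff_partial torus_smooth_partial_power)

definition sobolev_weight :: "real \<Rightarrow> int^'n::finite \<Rightarrow> real" where
  "sobolev_weight s k = (1 + laplace_eigenvalue k) powr s"

lemma sobolev_norm_weight:
  "sobolev_norm s f = sqrt (\<Sum>\<^sub>\<infinity>k\<in>UNIV. sobolev_weight s k * (cmod (fourier_coeff f k))\<^sup>2)"
  by (simp add: sobolev_norm_def sobolev_weight_def laplace_eigenvalue_def)

lemma laplace_eigenvalue_nonneg: "0 \<le> laplace_eigenvalue k"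
  by (simp add: laplace_eigenvalue_def)

text \<open>Without summability the infinite sum in \<open>sobolev_norm\<close> could take its
  default value 0 and would bound nothing. The partial sums are bounded by Bessel's inequality for
  \<open>f\<close> and its pure derivatives of order \<open>p\<close>.\<close>

lemma sobolev_summable:
  fixes f :: "real^'n::finite \<Rightarrow> complex"
  assumes sm: "torus_smooth f"
  shows "(\<lambda>k. sobolev_weight s k * (cmod (fourier_coeff f k))\<^sup>2) summable_on UNIV"
proof (rule nonneg_bdd_above_summable_on)
  \<comment> \<open>Rounding the order up to an integer turns the weight into a polynomial in the
    frequencies.\<close>
  obtain p :: nat where p: "s \<le> real p" using real_arch_simple by blast
  let ?C = "(real CARD('n) + 1) ^ p"
  let ?B = "?C * ((L2_norm f)\<^sup>2 + (\<Sum>i\<in>UNIV. (L2_norm ((partial i ^^ p) f))\<^sup>2))"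
  have wt: "sobolev_weight s k * (cmod (fourier_coeff f k))\<^sup>2 \<le>
      ?C * ((cmod (fourier_coeff f k))\<^sup>2 + (\<Sum>i\<in>UNIV. (cmod (fourier_coeff ((partial i ^^ p) f) k))\<^sup>2))" for k
  proof -
    have eqi: "((2 * pi * of_int (k $ i)) ^ p)\<^sup>2 * (cmod (fourier_coeff f k))\<^sup>2 =
        (cmod (fourier_coeff ((partial i ^^ p) f) k))\<^sup>2" for i
    proof -
      have "cmod (2 * pi * \<i> * of_int (k $ i)) = \<bar>2 * pi * of_int (k $ i)\<bar>"
        by (simp add: norm_mult abs_mult)
      then have "(cmod ((2 * pi * \<i> * of_int (k $ i)) ^ p))\<^sup>2 = ((2 * pi * of_int (k $ i)) ^ p)\<^sup>2"
        by (simp add: norm_power flip: power_abs)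
      then show ?thesis
        by (simp add: fourier_coeff_partial_power[OF sm] norm_mult power_mult_distrib)
    qed
    have "sobolev_weight s k \<le> (1 + laplace_eigenvalue k) powr real p"
      unfolding sobolev_weight_def using p laplace_eigenvalue_nonneg[of k] by (intro powr_mono) auto
    also have "\<dots> = (1 + laplace_eigenvalue k) ^ p"
      using laplace_eigenvalue_nonneg[of k] by (intro powr_realpow) auto
    also have "laplace_eigenvalue k = (\<Sum>i\<in>UNIV. (2 * pi * of_int (k $ i))\<^sup>2)"
      by (simp add: laplace_eigenvalue_def norm_sq_vec sum_distrib_left power_mult_distrib mult_ac)
    also have "(1 + \<dots>) ^ p \<le> ?C * (1 + (\<Sum>i\<in>UNIV. ((2 * pi * of_int (k $ i)) ^ p)\<^sup>2))"
      by (rule sum_power_bound)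
    finally have "sobolev_weight s k * (cmod (fourier_coeff f k))\<^sup>2 \<le>
        (?C * (1 + (\<Sum>i\<in>UNIV. ((2 * pi * of_int (k $ i)) ^ p)\<^sup>2))) * (cmod (fourier_coeff f k))\<^sup>2"
      by (rule mult_right_mono) simp
    also have "\<dots> = ?C * ((cmod (fourier_coeff f k))\<^sup>2 +
        (\<Sum>i\<in>UNIV. ((2 * pi * of_int (k $ i)) ^ p)\<^sup>2 * (cmod (fourier_coeff f k))\<^sup>2))"
      by (simp add: distrib_right sum_distrib_right mult.assoc)
    also have "\<dots> = ?C * ((cmod (fourier_coeff f k))\<^sup>2 +
        (\<Sum>i\<in>UNIV. (cmod (fourier_coeff ((partial i ^^ p) f) k))\<^sup>2))"
      by (simp only: eqi)
    finally show ?thesis .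
  qed
  have "(\<Sum>k\<in>F. sobolev_weight s k * (cmod (fourier_coeff f k))\<^sup>2) \<le> ?B" if F: "finite F" for F
  proof -
    have "(\<Sum>k\<in>F. sobolev_weight s k * (cmod (fourier_coeff f k))\<^sup>2) \<le>
        (\<Sum>k\<in>F. ?C * ((cmod (fourier_coeff f k))\<^sup>2 + (\<Sum>i\<in>UNIV. (cmod (fourier_coeff ((partial i ^^ p) f) k))\<^sup>2)))"
      by (intro sum_mono wt)
    also have "\<dots> = ?C * ((\<Sum>k\<in>F. (cmod (fourier_coeff f k))\<^sup>2) +
        (\<Sum>i\<in>UNIV. \<Sum>k\<in>F. (cmod (fourier_coeff ((partial i ^^ p) f) k))\<^sup>2))"
      unfolding sum.swap[of _ F UNIV] by (simp only: sum_distrib_left[symmetric] sum.distrib)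
    also have "\<dots> \<le> ?B"
      using sm by (intro mult_left_mono add_mono sum_mono bessel torus_smooth_continuous
          torus_smooth_partial_power F) auto
    finally show ?thesis .
  qed
  then show "bdd_above (sum (\<lambda>k. sobolev_weight s k * (cmod (fourier_coeff f k))\<^sup>2) ` {F. F \<subseteq> UNIV \<and> finite F})"
    by (intro bdd_aboveI2[where M = ?B]) auto
qed (simp add: sobolev_weight_def)

lemma sobolev_partial_sum_le:
  fixes f :: "real^'n::finite \<Rightarrow> complex"
  assumes "torus_smooth f" "finite F"
  shows "(\<Sum>k\<in>F. sobolev_weight s k * (cmod (fourier_coeff f k))\<^sup>2) \<le> (sobolev_norm s f)\<^sup>2"
proof -
  have "0 \<le> (\<Sum>\<^sub>\<infinity>k\<in>UNIV. sobolev_weight s k * (cmod (fourier_coeff f k))\<^sup>2)"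
    by (intro infsum_nonneg) (simp add: sobolev_weight_def)
  moreover have "(\<Sum>k\<in>F. sobolev_weight s k * (cmod (fourier_coeff f k))\<^sup>2) \<le>
      (\<Sum>\<^sub>\<infinity>k\<in>UNIV. sobolev_weight s k * (cmod (fourier_coeff f k))\<^sup>2)"
    using assms by (intro finite_sum_le_infsum sobolev_summable) (auto simp: sobolev_weight_def)
  ultimately show ?thesis by (simp add: sobolev_norm_weight)
qed

section \<open>Lattice counts for the spectral window as h tends to 0\<close>

lemma card_shell_lower_asymp:
  assumes d: "2 \<le> CARD('n::finite)" and \<alpha>: "0 < \<alpha>"
  shows "\<exists>c>0. \<exists>h0\<in>{0<..1}. \<forall>h\<in>{0<..h0}. (c / h) ^ (CARD('n) - 1) \<le> real (card (shell \<alpha> h :: (int^'n) set))"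
proof -
  \<comment> \<open>The term \<alpha>^2 / (32 pi^2) makes sqrt (2 \<eta> A) at most L / 4, so the
    overshoot uses half of the thickness; the term 1/2 keeps \<eta> below 1.\<close>
  define \<eta> where "\<eta> = min (1 / 2) (\<alpha>\<^sup>2 / (32 * pi\<^sup>2))"
  \<comment> \<open>Chosen so that \<kappa> / h \<le> u, given A \<ge> 1 / (8 pi^2 h^2).\<close>
  define \<kappa> where "\<kappa> = 1 / sqrt (8 * pi\<^sup>2 * (real CARD('n) - 1))"
  \<comment> \<open>The entries after 1 ensure, in this order, \<alpha> h \<le> 1/2 and hence the
    lower bound for \<open>A\<close>, then 1 \<le> L / 2, then \<eta> u \<ge> 2.\<close>
  define h0 where "h0 = Min {1, 1 / (2 * \<alpha>), \<alpha> / (4 * pi\<^sup>2), \<eta> * \<kappa> / 2}"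
  have d1: "0 < real CARD('n) - 1" using d by linarith
  have "0 < \<alpha>\<^sup>2 / (32 * pi\<^sup>2)" using \<alpha> by simp
  moreover have "\<eta> \<le> \<alpha>\<^sup>2 / (32 * pi\<^sup>2)" "\<eta> \<le> 1 / 2" unfolding \<eta>_def by simp_all
  ultimately have \<eta>: "0 < \<eta>" "\<eta> < 1" "2 * \<eta> \<le> \<alpha>\<^sup>2 / (16 * pi\<^sup>2)"
    by (simp_all add: \<eta>_def)
  have \<kappa>: "0 < \<kappa>" using d1 by (simp add: \<kappa>_def)
  have h0: "0 < h0" "h0 \<le> 1" "h0 \<le> 1 / (2 * \<alpha>)" "h0 \<le> \<alpha> / (4 * pi\<^sup>2)" "h0 \<le> \<eta> * \<kappa> / 2"
    using \<alpha> \<eta> \<kappa> by (auto simp: h0_def)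
  have "(\<eta> * \<kappa> / 2 / h) ^ (CARD('n) - 1) \<le> real (card (shell \<alpha> h :: (int^'n) set))"
    if h: "0 < h" "h \<le> h0" for h
  proof -
    define A where "A = (1 - \<alpha> * h) / (4 * pi\<^sup>2 * h\<^sup>2)"
    define L where "L = \<alpha> / (2 * pi\<^sup>2 * h)"
    define u where "u = sqrt (A / (real CARD('n) - 1))"
    have "h \<le> 1 / (2 * \<alpha>)" using h h0 by linarith
    then have ah: "\<alpha> * h \<le> 1 / 2" using \<alpha> by (simp add: field_simps)
    have p: "0 < 4 * pi\<^sup>2 * h\<^sup>2" using h by simp
    have A_lower: "1 / (8 * pi\<^sup>2 * h\<^sup>2) \<le> A"
      unfolding A_def using ah h by (simp add: field_simps)
    have A_upper: "A \<le> 1 / (4 * pi\<^sup>2 * h\<^sup>2)"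
      unfolding A_def using \<alpha> h by (intro divide_right_mono) auto
    have A0: "0 < A" using A_lower h by (smt (verit) divide_pos_pos mult_pos_pos pi_gt_zero zero_less_power)
    have "2 * \<eta> * A \<le> (\<alpha>\<^sup>2 / (16 * pi\<^sup>2)) * (1 / (4 * pi\<^sup>2 * h\<^sup>2))"
      using \<eta> A_upper A0 by (intro mult_mono) auto
    also have "\<dots> = (\<alpha> / (8 * pi\<^sup>2 * h))\<^sup>2" by (simp add: power2_eq_square)
    finally have "sqrt (2 * \<eta> * A) \<le> \<alpha> / (8 * pi\<^sup>2 * h)"
      using \<alpha> h by (intro real_le_lsqrt) auto
    moreover have "1 \<le> \<alpha> / (4 * pi\<^sup>2 * h)"
    proof -
      have "h \<le> \<alpha> / (4 * pi\<^sup>2)" using h h0 by linarith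
      then have "h * (4 * pi\<^sup>2) \<le> \<alpha>" by (simp add: pos_le_divide_eq)
      then show ?thesis using h by (simp add: pos_le_divide_eq mult_ac)
    qed
    moreover have "2 * (\<alpha> / (8 * pi\<^sup>2 * h)) + \<alpha> / (4 * pi\<^sup>2 * h) = L"
      using h by (simp add: L_def field_simps)
    ultimately have L: "2 * sqrt (2 * \<eta> * A) + 1 \<le> L" by linarith
    have "(\<kappa> / h)\<^sup>2 = 1 / (8 * pi\<^sup>2 * h\<^sup>2) / (real CARD('n) - 1)"
      using d1 h by (simp add: \<kappa>_def power_divide power_mult_distrib)
    also have "\<dots> \<le> A / (real CARD('n) - 1)" using A_lower d1 by (intro divide_right_mono) auto
    finally have u: "\<kappa> / h \<le> u" unfolding u_def by (intro real_le_rsqrt)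
    have "h \<le> \<eta> * \<kappa> / 2" using h h0 by linarith
    then have "2 \<le> \<eta> * (\<kappa> / h)" using h by (simp add: field_simps)
    also have "\<dots> \<le> \<eta> * u" using u \<eta> by (intro mult_left_mono) auto
    finally have u2: "2 \<le> \<eta> * u" .
    have "(\<eta> * \<kappa> / 2 / h) ^ (CARD('n) - 1) \<le> (\<eta> * u / 2) ^ (CARD('n) - 1)"
      using u \<eta> \<kappa> h by (intro power_mono) (auto simp: field_simps)
    also have "\<dots> \<le> real (card {k :: int^'n. A \<le> (norm (lattice_vec k :: real^'n))\<^sup>2 \<and>
        (norm (lattice_vec k :: real^'n))\<^sup>2 \<le> A + L})"
      using card_shell_lower[OF d A0 \<eta>(1,2) L] u2 by (simp add: u_def)
    also have "{k :: int^'n. A \<le> (norm (lattice_vec k :: real^'n))\<^sup>2 \<and>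
        (norm (lattice_vec k :: real^'n))\<^sup>2 \<le> A + L} = shell \<alpha> h"
      using shell_iff[OF h(1), of _ \<alpha>] by (auto simp: A_def L_def)
    finally show ?thesis .
  qed
  then show ?thesis using \<eta> \<kappa> h0 by (intro exI[of _ "\<eta> * \<kappa> / 2"] conjI bexI[of _ h0]) auto
qed

text \<open>The threshold on \<open>m\<close> reads |m|^2 \<le> 1 / (8 pi^2 h^2), and the right side
  is a lower bound for \<open>A\<close> once \<alpha> h \<le> 1/2.\<close>

lemma card_shell_upper_asymp:
  assumes \<alpha>: "0 < \<alpha>"
  shows "\<exists>C>0. \<exists>h0\<in>{0<..1}. \<forall>h\<in>{0<..h0}. \<forall>m :: int^'n::finite. m \<noteq> 0 \<and> 8 * pi\<^sup>2 * h\<^sup>2 * (norm (lattice_vec m :: real^'n))\<^sup>2 \<le> 1 \<longrightarrow>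
    real (card {k \<in> shell \<alpha> h. norm (lattice_vec (k + m) :: real^'n) = norm (lattice_vec k :: real^'n)})
      \<le> C * (1 / h) ^ (CARD('n) - 2)"
proof -
  let ?d = "real CARD('n)"
  \<comment> \<open>With the \<delta> chosen below, L / (2 \<delta>) = 2 \<alpha> d / pi, which is
    at most \<alpha> d and independent of \<open>h\<close>: the powers of h in slope and thickness
    cancel.\<close>
  define q where "q = nat \<lceil>\<alpha> * ?d\<rceil> + 1"
  \<comment> \<open>The 3 comes from 2 R + 1 \<le> 3 / h for R = 1 / h and h \<le> 1.\<close>
  define C where "C = 2 * ?d * real q * 3 ^ (CARD('n) - 2)"
  define h0 where "h0 = min 1 (1 / (2 * \<alpha>))"
  have h0: "0 < h0" "h0 \<le> 1" "h0 \<le> 1 / (2 * \<alpha>)" using \<alpha> by (auto simp: h0_def)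
  have C: "0 < C" by (simp add: C_def q_def)
  have q: "\<alpha> * ?d < real q" unfolding q_def by linarith
  have "real (card {k \<in> shell \<alpha> h. norm (lattice_vec (k + m) :: real^'n) = norm (lattice_vec k :: real^'n)})
      \<le> C * (1 / h) ^ (CARD('n) - 2)"
    if h: "0 < h" "h \<le> h0" and m: "m \<noteq> 0" "8 * pi\<^sup>2 * h\<^sup>2 * (norm (lattice_vec m :: real^'n))\<^sup>2 \<le> 1" for h and m :: "int^'n"
  proof -
    define A where "A = (1 - \<alpha> * h) / (4 * pi\<^sup>2 * h\<^sup>2)"
    define L where "L = \<alpha> / (2 * pi\<^sup>2 * h)"
    \<comment> \<open>Then (\<delta> d)^2 = 1 / (64 pi^2 h^2), one eighth of the lower bound for
      \<open>A\<close>, well below the permitted 3/4 A.\<close>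
    define \<delta> where "\<delta> = 1 / (8 * pi * h * ?d)"
    have "h \<le> 1 / (2 * \<alpha>)" using h h0 by linarith
    then have ah: "\<alpha> * h \<le> 1 / 2" using \<alpha> by (simp add: field_simps)
    have A_lower: "1 / (8 * pi\<^sup>2 * h\<^sup>2) \<le> A"
      unfolding A_def using ah h by (simp add: field_simps)
    have mA: "(norm (lattice_vec m :: real^'n))\<^sup>2 \<le> A"
    proof -
      have "0 < 8 * pi\<^sup>2 * h\<^sup>2" using h by simp
      then have "(norm (lattice_vec m :: real^'n))\<^sup>2 \<le> 1 / (8 * pi\<^sup>2 * h\<^sup>2)"
        using m(2) by (simp add: pos_le_divide_eq mult_ac)
      then show ?thesis using A_lower by linarith
    qed
    have R: "A + L \<le> (1 / h)\<^sup>2"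
    proof -
      have "A + L = (1 + \<alpha> * h) / (4 * pi\<^sup>2) * (1 / h)\<^sup>2"
        using h by (simp add: A_def L_def field_simps power2_eq_square)
      moreover have "(1 + \<alpha> * h) / (4 * pi\<^sup>2) \<le> 1"
      proof -
        have "1 \<le> pi\<^sup>2" using pi_ge_two by (simp add: one_le_power)
        then show ?thesis using ah by (simp add: divide_le_eq)
      qed
      ultimately show ?thesis by (metis mult_left_le_one_le mult_right_mono mult_1 zero_le_power2)
    qed
    have \<delta>: "0 < \<delta>" using h by (simp add: \<delta>_def)
    have "(\<delta> * ?d)\<^sup>2 = 1 / 8 * (1 / (8 * pi\<^sup>2 * h\<^sup>2))"
      using h by (simp add: \<delta>_def power2_eq_square field_simps)
    also have "\<dots> \<le> 3 / 4 * A"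
      using A_lower h by (intro mult_mono) auto
    finally have \<delta>2: "(\<delta> * ?d)\<^sup>2 \<le> 3 / 4 * A" .
    have qL: "L < 2 * \<delta> * real q"
    proof -
      have "L = (2 * (\<alpha> * ?d) / pi) * (1 / (4 * pi * h * ?d))"
        using h by (simp add: L_def field_simps power2_eq_square)
      also have "\<dots> < real q * (1 / (4 * pi * h * ?d))"
      proof (rule mult_strict_right_mono)
        have "2 * (\<alpha> * ?d) \<le> pi * (\<alpha> * ?d)" using \<alpha> pi_ge_two by (intro mult_right_mono) auto
        then have "2 * (\<alpha> * ?d) / pi \<le> \<alpha> * ?d" by (simp add: divide_le_eq mult_ac)
        then show "2 * (\<alpha> * ?d) / pi < real q" using q by linarith
      qed (use h in simp)
      finally show ?thesis using h by (simp add: \<delta>_def field_simps)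
    qed
    have eq: "{k \<in> shell \<alpha> h. norm (lattice_vec (k + m) :: real^'n) = norm (lattice_vec k :: real^'n)} =
      {k. A \<le> (norm (lattice_vec k :: real^'n))\<^sup>2 \<and> (norm (lattice_vec k :: real^'n))\<^sup>2 \<le> A + L
      \<and> (norm (lattice_vec (k + m) :: real^'n))\<^sup>2 = (norm (lattice_vec k :: real^'n))\<^sup>2}"
      using shell_iff[OF h(1), of _ \<alpha>] by (auto simp: A_def L_def)
    have "real (card {k \<in> shell \<alpha> h. norm (lattice_vec (k + m) :: real^'n) = norm (lattice_vec k :: real^'n)}) \<le>
        2 * ?d * real q * (2 * (1 / h) + 1) ^ (CARD('n) - 2)"
      unfolding eq using h by (intro card_shell_hyperplane[OF m(1) mA _ R \<delta> \<delta>2 qL]) simp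
    also have "\<dots> \<le> 2 * ?d * real q * (3 * (1 / h)) ^ (CARD('n) - 2)"
      using h h0 by (intro mult_left_mono power_mono) (auto simp: field_simps)
    finally show ?thesis by (simp only: C_def power_mult_distrib mult.assoc)
  qed
  then show ?thesis using C h0 by (intro exI[of _ C] conjI bexI[of _ h0]) auto
qed

text \<open>Dividing the orders h^-(d-2) and h^-(d-1) of the two counts leaves one factor
  \<open>h\<close>.\<close>

lemma card_shell_ratio:
  assumes d: "2 \<le> CARD('n::finite)" and \<alpha>: "0 < \<alpha>"
  shows "\<exists>C>0. \<exists>h0\<in>{0<..1}. \<forall>h\<in>{0<..h0}. \<forall>m :: int^'n. m \<noteq> 0 \<and> 8 * pi\<^sup>2 * h\<^sup>2 * (norm (lattice_vec m :: real^'n))\<^sup>2 \<le> 1 \<longrightarrow>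
    real (card {k \<in> shell \<alpha> h. norm (lattice_vec (k + m) :: real^'n) = norm (lattice_vec k :: real^'n)})
      \<le> C * h * real (card (shell \<alpha> h :: (int^'n) set))"
proof -
  obtain c h1 where c: "0 < c" and h1: "h1 \<in> {0<..1}"
    and lower: "\<And>h. h \<in> {0<..h1} \<Longrightarrow> (c / h) ^ (CARD('n) - 1) \<le> real (card (shell \<alpha> h :: (int^'n) set))"
    using card_shell_lower_asymp[OF d \<alpha>] by metis
  obtain C h2 where C: "0 < C" and h2: "h2 \<in> {0<..1}"
    and upper: "\<forall>h\<in>{0<..h2}. \<forall>m :: int^'n. m \<noteq> 0 \<and> 8 * pi\<^sup>2 * h\<^sup>2 * (norm (lattice_vec m :: real^'n))\<^sup>2 \<le> 1 \<longrightarrow>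
    real (card {k \<in> shell \<alpha> h. norm (lattice_vec (k + m) :: real^'n) = norm (lattice_vec k :: real^'n)})
      \<le> C * (1 / h) ^ (CARD('n) - 2)"
    using card_shell_upper_asymp[OF \<alpha>, where 'n = 'n] by (elim exE conjE bexE) (rule that)
  have ratio: "C * (1 / h) ^ (CARD('n) - 2) \<le> C / c ^ (CARD('n) - 1) * h * real (card (shell \<alpha> h :: (int^'n) set))"
    if h: "h \<in> {0<..min h1 h2}" for h
  proof -
    \<comment> \<open>With d \<ge> 2 the truncated subtractions in the two exponents are
      exact.\<close>
    have e: "CARD('n) - 1 = Suc (CARD('n) - 2)" using d by linarith
    have "(c / h) ^ Suc n = c ^ Suc n * ((1 / h) ^ n / h)" for n
      by (simp add: power_divide)
    then have "C * (1 / h) ^ (CARD('n) - 2) = C / c ^ (CARD('n) - 1) * h * (c / h) ^ (CARD('n) - 1)"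
      using h c unfolding e by simp
    also have "\<dots> \<le> C / c ^ (CARD('n) - 1) * h * real (card (shell \<alpha> h :: (int^'n) set))"
      using h c C lower[of h] by (intro mult_left_mono) auto
    finally show ?thesis .
  qed
  have "real (card {k \<in> shell \<alpha> h. norm (lattice_vec (k + m) :: real^'n) = norm (lattice_vec k :: real^'n)})
      \<le> C / c ^ (CARD('n) - 1) * h * real (card (shell \<alpha> h :: (int^'n) set))"
    if h: "h \<in> {0<..min h1 h2}"
      and m: "m \<noteq> 0 \<and> 8 * pi\<^sup>2 * h\<^sup>2 * (norm (lattice_vec m :: real^'n))\<^sup>2 \<le> 1" for h and m :: "int^'n"
  proof -
    have "h \<in> {0<..h2}" using h by simp
    from upper[rule_format, OF this m] ratio[OF h] show ?thesis by (rule order_trans)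
  qed
  moreover have "0 < C / c ^ (CARD('n) - 1)" "min h1 h2 \<in> {0<..1}" using C c h1 h2 by auto
  ultimately show ?thesis
    by (intro exI[of _ "C / c ^ (CARD('n) - 1)"] conjI bexI[of _ "min h1 h2"]) simp_all
qed

section \<open>The quantum variance\<close>

text \<open>Both integrals average \<open>a\<close> against probability measures, |\<psi>|^2 dx and
  dx.\<close>

lemma matrix_element_bound:
  fixes a \<psi> :: "real^'n::finite \<Rightarrow> complex"
  assumes a: "continuous_on UNIV a" and \<psi>: "continuous_on UNIV \<psi>"
    and unit: "L2_inner \<psi> \<psi> = 1" and M: "\<And>x. cmod (a x) \<le> M"
  shows "(cmod (torus_integral (\<lambda>x. a x * of_real ((cmod (\<psi> x))\<^sup>2)) - torus_integral a))\<^sup>2 \<le> 4 * M\<^sup>2"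
proof -
  have c2: "continuous_on UNIV (\<lambda>x. (cmod (\<psi> x))\<^sup>2)" using \<psi> by (intro continuous_intros)
  have "of_real (torus_integral (\<lambda>x. (cmod (\<psi> x))\<^sup>2)) = L2_inner \<psi> \<psi>"
    by (simp only: L2_inner_def torus_integral_of_real[OF c2, symmetric] complex_norm_square)
  then have one: "torus_integral (\<lambda>x. (cmod (\<psi> x))\<^sup>2) = 1" by (simp add: unit)
  have cont: "continuous_on UNIV (\<lambda>x. a x * of_real ((cmod (\<psi> x))\<^sup>2))"
    using a \<psi> by (intro continuous_intros)
  have "cmod (torus_integral (\<lambda>x. a x * of_real ((cmod (\<psi> x))\<^sup>2))) \<le>
      torus_integral (\<lambda>x. cmod (a x * of_real ((cmod (\<psi> x))\<^sup>2)))"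
    by (rule torus_integral_norm_le[OF cont])
  also have "\<dots> \<le> torus_integral (\<lambda>x. M * (cmod (\<psi> x))\<^sup>2)"
  proof (rule torus_integral_mono)
    show "continuous_on UNIV (\<lambda>x. cmod (a x * of_real ((cmod (\<psi> x))\<^sup>2)))"
      using cont by (rule continuous_on_norm)
    show "continuous_on UNIV (\<lambda>x. M * (cmod (\<psi> x))\<^sup>2)"
      using c2 by (intro continuous_on_mult continuous_on_const)
    show "cmod (a x * of_real ((cmod (\<psi> x))\<^sup>2)) \<le> M * (cmod (\<psi> x))\<^sup>2" for x
      using M[of x] by (simp add: norm_mult norm_power mult_right_mono)
  qed
  also have "\<dots> = M"
    using c2 one by (simp add: torus_integral_HK continuous_on_mult continuous_on_const)
  finally have 1: "cmod (torus_integral (\<lambda>x. a x * of_real ((cmod (\<psi> x))\<^sup>2))) \<le> M" .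
  have "cmod (torus_integral a) \<le> torus_integral (\<lambda>x. cmod (a x))"
    by (rule torus_integral_norm_le[OF a])
  also have "\<dots> \<le> torus_integral (\<lambda>x::real^'n. M)"
    by (intro torus_integral_mono continuous_on_norm a continuous_on_const M)
  finally have 2: "cmod (torus_integral a) \<le> M" by (simp add: torus_integral_const)
  have "cmod (torus_integral (\<lambda>x. a x * of_real ((cmod (\<psi> x))\<^sup>2)) - torus_integral a) \<le> 2 * M"
    using 1 2 norm_triangle_ineq4[of "torus_integral (\<lambda>x. a x * of_real ((cmod (\<psi> x))\<^sup>2))" "torus_integral a"]
    by linarith
  then have "(cmod (torus_integral (\<lambda>x. a x * of_real ((cmod (\<psi> x))\<^sup>2)) - torus_integral a))\<^sup>2 \<le> (2 * M)\<^sup>2"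
    by (rule power_mono) simp
  then show ?thesis by (simp add: power_mult_distrib)
qed

lemma quantum_variance_trivial_bound:
  fixes a :: "real^'n::finite \<Rightarrow> complex" and \<psi> :: "nat \<Rightarrow> real^'n \<Rightarrow> complex"
  assumes a: "continuous_on UNIV a" and M: "\<And>x. cmod (a x) \<le> M" and onb: "eigen_onb \<alpha> h \<psi>"
  shows "1 / real (spectral_dim TYPE('n) \<alpha> h) * (\<Sum>j = 1..spectral_dim TYPE('n) \<alpha> h.
    (cmod (torus_integral (\<lambda>x. a x * of_real ((cmod (\<psi> j x))\<^sup>2)) - torus_integral a))\<^sup>2) \<le> 4 * M\<^sup>2"
proof -
  let ?N = "spectral_dim TYPE('n) \<alpha> h"
  have "(\<Sum>j = 1..?N. (cmod (torus_integral (\<lambda>x. a x * of_real ((cmod (\<psi> j x))\<^sup>2)) - torus_integral a))\<^sup>2) \<le>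
      (\<Sum>j = 1..?N. 4 * M\<^sup>2)"
  proof (intro sum_mono matrix_element_bound a M)
    fix j assume "j \<in> {1..?N}"
    then have "\<exists>E. eigenfunction h E (\<psi> j)" and "L2_inner (\<psi> j) (\<psi> j) = 1"
      using onb unfolding eigen_onb_def by auto
    then show "continuous_on UNIV (\<psi> j)" "L2_inner (\<psi> j) (\<psi> j) = 1"
      by (auto simp: eigenfunction_def torus_smooth_continuous)
  qed
  also have "\<dots> = real ?N * (4 * M\<^sup>2)" by simp
  finally have "1 / real ?N * (\<Sum>j = 1..?N. (cmod (torus_integral (\<lambda>x. a x * of_real ((cmod (\<psi> j x))\<^sup>2)) - torus_integral a))\<^sup>2)
      \<le> 1 / real ?N * (real ?N * (4 * M\<^sup>2))"
    by (rule mult_left_mono) simp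
  \<comment> \<open>An inequality, because for dimension 0 the left side is 0 by the convention 1 /
    0 = 0.\<close>
  also have "\<dots> \<le> 4 * M\<^sup>2" by simp
  finally show ?thesis .
qed

lemma quantum_variance_bound:
  assumes d: "2 \<le> CARD('n::finite)" and \<alpha>: "0 < \<alpha>" and s: "1 \<le> s"
  shows "\<exists>C>0. \<exists>h0\<in>{0<..1}. \<forall>h\<in>{0<..h0}. \<forall>(a :: real^'n \<Rightarrow> complex) \<psi>. torus_smooth a \<and> eigen_onb \<alpha> h \<psi> \<longrightarrow>
    1 / real (spectral_dim TYPE('n) \<alpha> h) * (\<Sum>j = 1..spectral_dim TYPE('n) \<alpha> h.
      (cmod (torus_integral (\<lambda>x. a x * of_real ((cmod (\<psi> j x))\<^sup>2)) - torus_integral a))\<^sup>2)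
    \<le> C * h * (L2_norm a)\<^sup>2 + 2 * h\<^sup>2 * (sobolev_norm s a)\<^sup>2"
proof -
  obtain C h0 where C: "0 < C" and h0: "h0 \<in> {0<..1}"
    and ratio: "\<forall>h\<in>{0<..h0}. \<forall>m :: int^'n. m \<noteq> 0 \<and> 8 * pi\<^sup>2 * h\<^sup>2 * (norm (lattice_vec m :: real^'n))\<^sup>2 \<le> 1 \<longrightarrow>
    real (card {k \<in> shell \<alpha> h. norm (lattice_vec (k + m) :: real^'n) = norm (lattice_vec k :: real^'n)})
      \<le> C * h * real (card (shell \<alpha> h :: (int^'n) set))"
    using card_shell_ratio[OF d \<alpha>] by (elim exE conjE bexE) (rule that)
  have "1 / real (spectral_dim TYPE('n) \<alpha> h) * (\<Sum>j = 1..spectral_dim TYPE('n) \<alpha> h.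
      (cmod (torus_integral (\<lambda>x. a x * of_real ((cmod (\<psi> j x))\<^sup>2)) - torus_integral a))\<^sup>2)
    \<le> C * h * (L2_norm a)\<^sup>2 + 2 * h\<^sup>2 * (sobolev_norm s a)\<^sup>2"
    if h: "h \<in> {0<..h0}" and a: "torus_smooth a" and onb: "eigen_onb \<alpha> h \<psi>"
    for h and a :: "real^'n \<Rightarrow> complex" and \<psi>
  proof -
    let ?\<Lambda> = "shell \<alpha> h :: (int^'n) set"
    let ?M = "\<lambda>m. card {k \<in> ?\<Lambda>. norm (lattice_vec (k + m) :: real^'n) = norm (lattice_vec k :: real^'n)}"
    let ?w = "\<lambda>m. sobolev_weight s m * (cmod (fourier_coeff a m))\<^sup>2"
    have hpos: "0 < h" using h by simp
    have cont: "continuous_on UNIV a" using a by (rule torus_smooth_continuous)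
    obtain D where D: "finite D" "0 \<notin> D" and le:
      "(\<Sum>j = 1..card ?\<Lambda>. (cmod (torus_integral (\<lambda>x. a x * of_real ((cmod (\<psi> j x))\<^sup>2)) - torus_integral a))\<^sup>2) \<le>
       (\<Sum>m\<in>D. (cmod (fourier_coeff a m))\<^sup>2 * real (?M m))"
      using eigen_variance_bound[OF hpos onb cont] .
    have M: "1 / real (card ?\<Lambda>) * real (?M m) \<le> C * h + 2 * h\<^sup>2 * sobolev_weight s m" if m: "m \<in> D" for m
    proof (cases "8 * pi\<^sup>2 * h\<^sup>2 * (norm (lattice_vec m :: real^'n))\<^sup>2 \<le> 1")
      case True
      have "m \<noteq> 0" using D m by auto
      with True have "real (?M m) \<le> C * h * real (card ?\<Lambda>)" using ratio h by blast
      then have "1 / real (card ?\<Lambda>) * real (?M m) \<le> 1 / real (card ?\<Lambda>) * (C * h * real (card ?\<Lambda>))"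
        by (rule mult_left_mono) simp
      also have "\<dots> \<le> C * h" using C hpos by simp
      also have "\<dots> \<le> C * h + 2 * h\<^sup>2 * sobolev_weight s m" by (simp add: sobolev_weight_def)
      finally show ?thesis .
    next
      case False
      have "?M m \<le> card ?\<Lambda>" by (intro card_mono finite_shell hpos) auto
      then have "1 / real (card ?\<Lambda>) * real (?M m) \<le> 1" by (simp add: divide_le_eq)
      \<comment> \<open>The frequency threshold, written with the eigenvalue 4 pi^2 |m|^2; this is
        the origin of the factor 2 in the Sobolev term.\<close>
      also have "1 \<le> 2 * h\<^sup>2 * laplace_eigenvalue m"
        using False by (simp add: laplace_eigenvalue_def mult_ac)
      also have "\<dots> \<le> 2 * h\<^sup>2 * sobolev_weight s m"
      proof (rule mult_left_mono)
        have "laplace_eigenvalue m \<le> (1 + laplace_eigenvalue m) powr 1"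
          using laplace_eigenvalue_nonneg[of m] by simp
        also have "\<dots> \<le> sobolev_weight s m"
          unfolding sobolev_weight_def using s laplace_eigenvalue_nonneg[of m] by (intro powr_mono) auto
        finally show "laplace_eigenvalue m \<le> sobolev_weight s m" .
      qed simp
      also have "\<dots> \<le> C * h + 2 * h\<^sup>2 * sobolev_weight s m" using C hpos by simp
      finally show ?thesis .
    qed
    have "1 / real (card ?\<Lambda>) * (\<Sum>j = 1..card ?\<Lambda>. (cmod (torus_integral (\<lambda>x. a x * of_real ((cmod (\<psi> j x))\<^sup>2)) - torus_integral a))\<^sup>2)
        \<le> 1 / real (card ?\<Lambda>) * (\<Sum>m\<in>D. (cmod (fourier_coeff a m))\<^sup>2 * real (?M m))"
      using le by (rule mult_left_mono) simp
    also have "\<dots> = (\<Sum>m\<in>D. (cmod (fourier_coeff a m))\<^sup>2 * (1 / real (card ?\<Lambda>) * real (?M m)))"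
      by (simp only: sum_distrib_left mult.left_commute)
    also have "\<dots> \<le> (\<Sum>m\<in>D. (cmod (fourier_coeff a m))\<^sup>2 * (C * h + 2 * h\<^sup>2 * sobolev_weight s m))"
      by (intro sum_mono mult_left_mono M) auto
    also have "\<dots> = (\<Sum>m\<in>D. C * h * (cmod (fourier_coeff a m))\<^sup>2 + 2 * h\<^sup>2 * ?w m)"
      by (intro sum.cong refl) (simp add: algebra_simps)
    also have "\<dots> = C * h * (\<Sum>m\<in>D. (cmod (fourier_coeff a m))\<^sup>2) + 2 * h\<^sup>2 * (\<Sum>m\<in>D. ?w m)"
      by (simp only: sum.distrib sum_distrib_left)
    also have "\<dots> \<le> C * h * (L2_norm a)\<^sup>2 + 2 * h\<^sup>2 * (sobolev_norm s a)\<^sup>2"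
      using C hpos by (intro add_mono mult_left_mono bessel cont D sobolev_partial_sum_le a) auto
    finally show ?thesis by (simp only: spectral_dim_eq[OF hpos])
  qed
  then show ?thesis using C h0 by (intro exI[of _ C] conjI bexI[of _ h0]) blast+
qed

text \<open>The empty list is the only one in which every count is 0, so the choice in
  \<open>multi_partial 0\<close> is determined and no derivative is taken.\<close>

lemma symbol_bounds_zero:
  fixes a :: "real \<Rightarrow> real^'n::finite \<Rightarrow> complex"
  assumes "symbol_bounds \<nu>1 c a" "h \<in> {0<..1}"
  shows "cmod (a h x) \<le> c 0"
proof -
  have "(SOME l. \<forall>i. count_list l i = (0 :: nat^'n) $ i) = []"
  proof (rule some_equality)
    fix l :: "'n list"
    assume "\<forall>i. count_list l i = (0 :: nat^'n) $ i"
    then show "l = []" by (cases l) (auto dest: spec[of _ "hd l"])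
  qed simp
  then have "multi_partial 0 (a h) x = a h x" by (simp add: multi_partial_def partials_def)
  moreover have "cmod (multi_partial 0 (a h) x) \<le> c 0 * h powr (- \<nu>1 * real (multi_order (0 :: nat^'n)))"
    using assms unfolding symbol_bounds_def by blast
  ultimately show ?thesis using assms(2) by (simp add: multi_order_def)
qed

theorem theorem1p4:
  fixes \<alpha> s :: real
  assumes d: "CARD('n::finite) \<ge> 2" and \<alpha>: "\<alpha> > 0" and s: "s > (real CARD('n) + 4) / 2"
  shows "\<exists>C>0. \<forall>\<nu>0\<ge>0. \<forall>\<nu>1\<ge>0.
    \<exists>(B :: (nat^'n) set) (K :: (nat^'n \<Rightarrow> real) \<Rightarrow> real).
      finite B \<and> (\<forall>c. K c > 0) \<and> (\<forall>c c'. (\<forall>\<beta>\<in>B. c \<beta> = c' \<beta>) \<longrightarrow> K c = K c') \<and>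
      (\<forall>(a :: real \<Rightarrow> real^'n \<Rightarrow> complex) c.
        (\<forall>h\<in>{0<..1}. torus_smooth (a h)) \<and> symbol_bounds \<nu>1 c a \<longrightarrow>
        (\<exists>h0\<in>{0<..1}. \<forall>h\<in>{0<..h0}. \<forall>\<psi> :: nat \<Rightarrow> real^'n \<Rightarrow> complex. eigen_onb \<alpha> h \<psi> \<longrightarrow>
          1 / real (spectral_dim TYPE('n) \<alpha> h) *
            (\<Sum>j = 1..spectral_dim TYPE('n) \<alpha> h.
              (cmod (torus_integral (\<lambda>x. a h x * of_real ((cmod (\<psi> j x))\<^sup>2))
                     - torus_integral (a h)))\<^sup>2)
          \<le> C * (L2_norm (a h))\<^sup>2 * h powr \<nu>0
            + C * (sobolev_norm s (a h))\<^sup>2 * h powr (2 - 2 * \<nu>0)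
            + K c * h powr (2 - 2 * (\<nu>0 + \<nu>1))))"
proof -
  have s1: "1 \<le> s" using s d by simp
  obtain C1 h1 where C1: "0 < C1" and h1: "h1 \<in> {0<..1}" and var:
    "\<forall>h\<in>{0<..h1}. \<forall>(a :: real^'n \<Rightarrow> complex) \<psi>. torus_smooth a \<and> eigen_onb \<alpha> h \<psi> \<longrightarrow>
    1 / real (spectral_dim TYPE('n) \<alpha> h) * (\<Sum>j = 1..spectral_dim TYPE('n) \<alpha> h.
      (cmod (torus_integral (\<lambda>x. a x * of_real ((cmod (\<psi> j x))\<^sup>2)) - torus_integral a))\<^sup>2)
    \<le> C1 * h * (L2_norm a)\<^sup>2 + 2 * h\<^sup>2 * (sobolev_norm s a)\<^sup>2"
    using quantum_variance_bound[OF d \<alpha> s1] by (elim exE conjE bexE) (rule that)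
  \<comment> \<open>One constant has to dominate both prefactors of the variance bound.\<close>
  define C where "C = max C1 2"
  have C: "0 < C" "C1 \<le> C" "2 \<le> C" by (auto simp: C_def)
  \<comment> \<open>The summand 1 keeps \<open>K c\<close> positive for arbitrary \<open>c\<close>,
    also when c 0 = 0.\<close>
  define K where "K c = 4 * (c 0)\<^sup>2 + 1" for c :: "nat^'n \<Rightarrow> real"
  have K: "0 < K c" for c unfolding K_def by (simp add: add_nonneg_pos)
  have main: "1 / real (spectral_dim TYPE('n) \<alpha> h) *
            (\<Sum>j = 1..spectral_dim TYPE('n) \<alpha> h.
              (cmod (torus_integral (\<lambda>x. a h x * of_real ((cmod (\<psi> j x))\<^sup>2))
                     - torus_integral (a h)))\<^sup>2)
          \<le> C * (L2_norm (a h))\<^sup>2 * h powr \<nu>0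
            + C * (sobolev_norm s (a h))\<^sup>2 * h powr (2 - 2 * \<nu>0)
            + K c * h powr (2 - 2 * (\<nu>0 + \<nu>1))" (is "?V \<le> ?R1 + ?R2 + ?R3")
    if \<nu>: "0 \<le> \<nu>0" "0 \<le> \<nu>1" and a: "\<forall>h\<in>{0<..1}. torus_smooth (a h)" "symbol_bounds \<nu>1 c a"
      and h: "h \<in> {0<..h1}" and onb: "eigen_onb \<alpha> h \<psi>"
    for \<nu>0 \<nu>1 h and a :: "real \<Rightarrow> real^'n \<Rightarrow> complex" and c and \<psi> :: "nat \<Rightarrow> real^'n \<Rightarrow> complex"
  proof -
    have h': "h \<in> {0<..1}" "0 < h" "h \<le> 1" using h h1 by auto
    have sm: "torus_smooth (a h)" using a(1) h' by blast
    have nn: "0 \<le> ?R1" "0 \<le> ?R2" "0 \<le> ?R3" using C K[of c] by simp_all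
    show ?thesis
    proof (cases "1 \<le> \<nu>0 + \<nu>1")
      case True
      have "?V \<le> 4 * (c 0)\<^sup>2"
        by (rule quantum_variance_trivial_bound[OF torus_smooth_continuous[OF sm] symbol_bounds_zero[OF a(2) h'(1)] onb])
      also have "\<dots> \<le> K c * 1" by (simp add: K_def)
      \<comment> \<open>The exponent 2 - 2 (\<nu>0 + \<nu>1) is at most 0 here, so for h \<le> 1 the
        power of \<open>h\<close> is at least 1.\<close>
      also have "\<dots> \<le> ?R3"
        using True h' K[of c] powr_mono'[of "2 - 2 * (\<nu>0 + \<nu>1)" 0 h] by (intro mult_left_mono) auto
      finally show ?thesis using nn by linarith
    next
      case False
      \<comment> \<open>As \<nu>1 \<ge> 0, the remaining case forces \<nu>0 \<le> 1. Then h \<le>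
        h^\<nu>0 and h^2 \<le> h^(2 - 2 \<nu>0) for h \<le> 1, which turns the variance bound into
        the first two terms.\<close>
      then have \<nu>0: "\<nu>0 \<le> 1" using \<nu> by linarith
      have "?V \<le> C1 * h * (L2_norm (a h))\<^sup>2 + 2 * h\<^sup>2 * (sobolev_norm s (a h))\<^sup>2"
        using var h sm onb by blast
      moreover have "C1 * h * (L2_norm (a h))\<^sup>2 \<le> C * h powr \<nu>0 * (L2_norm (a h))\<^sup>2"
        using C C1 h' \<nu>0 powr_mono'[of \<nu>0 1 h] by (intro mult_right_mono mult_mono) auto
      moreover have "2 * h\<^sup>2 * (sobolev_norm s (a h))\<^sup>2 \<le> C * h powr (2 - 2 * \<nu>0) * (sobolev_norm s (a h))\<^sup>2"
        using C h' \<nu> powr_mono'[of "2 - 2 * \<nu>0" 2 h] by (intro mult_right_mono mult_mono) auto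
      ultimately show ?thesis using nn by (simp only: mult.commute mult.left_commute)
    qed
  qed
  show ?thesis
  \<comment> \<open>Only the sup bound \<open>c 0\<close> enters \<open>K\<close>, hence the witness
    \<open>{0}\<close> for the finite set of multi-indices.\<close>
  proof (intro exI[of _ C] conjI allI impI C exI[of _ "{0}"] exI[of _ K] K)
    show "K c = K c'" if "\<forall>\<beta>\<in>{0}. c \<beta> = c' \<beta>" for c c' using that by (simp add: K_def)
  qed (use main h1 in blast)+
qed

end
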